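(* The group $\mathrm{PC}^{\bowtie}(\mathbf{S})$ is not realizable. More precisely, its subgroup $\mathrm{IET}^{\pm}(\mathbf{S})$ is not realizable, and $\mathrm{IET}^{\pm}(\mathbf{S})$ even has a finitely generated subgroup that is not realizable.
   Context: Let $\mathbf{S}=\mathbf{R}/\mathbf{Z}$. Let $\widehat{\mathrm{PC}^{\bowtie}}(\mathbf{S})$ be the group of permutations of $\mathbf{S}$ that are continuous outside a finite subset; let $\mathfrak{S}_{\mathrm{fin}}(\mathbf{S})$ be its normal subgroup of finitely supported permutations; let $\mathrm{PC}^{\bowtie}(\mathbf{S})=\widehat{\mathrm{PC}^{\bowtie}}(\mathbf{S})/\mathfrak{S}_{\mathrm{fin}}(\mathbf{S})$ with quotient homomorphism $\pi$. $\mathrm{PC}^{+}(\mathbf{S})$ is the subgroup of $\mathrm{PC}^{\bowtie}(\mathbf{S})$ of piecewise orientation-preserving elements, $\mathrm{PC}^{-}(\mathbf{S})$ is the subset of piecewise orientation-reversing elements (i.e. orientation-reversing on every piece), and $\mathrm{PC}^{\pm}(\mathbf{S})=\mathrm{PC}^{+}(\mathbf{S})\sqcup\mathrm{PC}^{-}(\mathbf{S})$, a subgroup. $\mathrm{IET}^{\bowtie}(\mathbf{S})$ is the subgroup of $\mathrm{PC}^{\bowtie}(\mathbf{S})$ of piecewise isometric elements (interval exchanges with flips), and $\mathrm{IET}^{\pm}(\mathbf{S})=\mathrm{PC}^{\pm}(\mathbf{S})\cap\mathrm{IET}^{\bowtie}(\mathbf{S})$. A subgroup $\Gamma\subset\mathrm{PC}^{\bowtie}(\mathbf{S})$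 is realizable if there is a subgroup $\Lambda$ of $\widehat{\mathrm{PC}^{\bowtie}}(\mathbf{S})$ such that $\pi$ restricts to a bijection $\Lambda\to\Gamma$. *)

theory Defs
  imports
    "HOL-Analysis.Analysis"
    "HOL-Algebra.Bij"
    "HOL-Algebra.Coset"
    "HOL-Algebra.Generated_Groups"
begin

section \<open>The circle \<open>\<real>/\<int>\<close>\<close>

quotient_type circle = real / "\<lambda>s t. s - t \<in> \<int>"
  morphisms rep_circle circle_of
proof (rule equivpI)
  show "reflp (\<lambda>s t::real. s - t \<in> \<int>)"
    by (simp add: reflp_def)
  show "symp (\<lambda>s t::real. s - t \<in> \<int>)"
    by (metis (no_types, lifting) Ints_minus minus_diff_eq sympI)
  show "transp (\<lambda>s t::real. s - t \<in> \<int>)"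
  proof (rule transpI)
    fix s t u :: real
    assume "s - t \<in> \<int>" "t - u \<in> \<int>"
    from Ints_add[OF this] show "s - u \<in> \<int>" by simp
  qed
qed

lemma circle_of_eq_iff: "circle_of s = circle_of t \<longleftrightarrow> s - t \<in> \<int>"
  by (rule circle.abs_eq_iff)

lemma circle_of_surj: obtains s where "x = circle_of s"
  by (metis Quotient_abs_rep Quotient_circle)

lemma circle_of_add_int: "circle_of (s + of_int n) = circle_of s"
  by (simp add: circle_of_eq_iff)

text \<open>The quotient metric; \<open>open_circle_iff\<close> below shows that it induces the quotient topology.\<close>

instantiation circle :: metric_space
begin

definition dist_circle :: "circle \<Rightarrow> circle \<Rightarrow> real" where
  "dist x y = Inf {\<bar>s - t\<bar> | s t. circle_of s = x \<and> circle_of t = y}"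

definition uniformity_circle :: "(circle \<times> circle) filter" where
  "uniformity = (INF e\<in>{0<..}. principal {(x :: circle, y). dist x y < e})"

definition open_circle :: "circle set \<Rightarrow> bool" where
  "open (U :: circle set) \<longleftrightarrow> (\<forall>x\<in>U. \<forall>\<^sub>F (x', y) in uniformity. x' = x \<longrightarrow> y \<in> U)"

lemma dist_circle_le: "dist (circle_of s) (circle_of t) \<le> \<bar>s - t\<bar>"
  unfolding dist_circle_def by (rule cInf_lower) (auto intro!: bdd_belowI[of _ 0])

lemma dist_circle_attained:
  obtains n :: int where "dist (circle_of s) (circle_of t) = \<bar>s - t - of_int n\<bar>"
proof
  let ?n = "round (s - t)"
  show "dist (circle_of s) (circle_of t) = \<bar>s - t - of_int ?n\<bar>"
  proof (rule antisym)
    show "dist (circle_of s) (circle_of t) \<le> \<bar>s - t - of_int ?n\<bar>"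
      using dist_circle_le[of s "t + of_int ?n"]
      by (simp add: circle_of_add_int algebra_simps)
    show "\<bar>s - t - of_int ?n\<bar> \<le> dist (circle_of s) (circle_of t)"
      unfolding dist_circle_def
    proof (rule cInf_greatest)
      show "{\<bar>s' - t'\<bar> |s' t'. circle_of s' = circle_of s \<and> circle_of t' = circle_of t} \<noteq> {}"
        by blast
      fix d assume "d \<in> {\<bar>s' - t'\<bar> |s' t'. circle_of s' = circle_of s \<and> circle_of t' = circle_of t}"
      then obtain s' t' where d: "d = \<bar>s' - t'\<bar>" "s' - s \<in> \<int>" "t' - t \<in> \<int>"
        by (auto simp: circle_of_eq_iff)
      then obtain i j :: int where "s' = s + of_int i" "t' = t + of_int j"
        by (metis Ints_cases add.commute diff_add_cancel)
      then have "d = \<bar>s - t - of_int (j - i)\<bar>"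
        using d by simp
      then show "\<bar>s - t - of_int ?n\<bar> \<le> d"
        using round_diff_minimal[of "s - t" "j - i"] by simp
    qed
  qed
qed

instance
proof
  show "uniformity = (INF e\<in>{0<..}. principal {(x::circle, y). dist x y < e})"
    by (rule uniformity_circle_def)
  show "open U \<longleftrightarrow> (\<forall>x\<in>U. \<forall>\<^sub>F (x', y) in uniformity. x' = x \<longrightarrow> y \<in> U)" for U :: "circle set"
    by (rule open_circle_def)
  show "dist x y = 0 \<longleftrightarrow> x = y" for x y :: circle
  proof -
    obtain s t where st: "x = circle_of s" "y = circle_of t"
      by (metis circle_of_surj)
    obtain n :: int where n: "dist x y = \<bar>s - t - of_int n\<bar>"
      unfolding st by (rule dist_circle_attained)
    have "x = y" if "dist x y = 0"
      using that n st by (auto simp: circle_of_eq_iff)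
    moreover have "dist x x = 0"
    proof -
      have "dist x x \<le> 0"
        using dist_circle_le[of s s] st by simp
      moreover obtain m :: int where "dist x x = \<bar>s - s - of_int m\<bar>"
        unfolding st by (rule dist_circle_attained)
      ultimately show ?thesis by simp
    qed
    ultimately show ?thesis by blast
  qed
  show "dist x y \<le> dist x z + dist y z" for x y z :: circle
  proof -
    obtain s t u where stu: "x = circle_of s" "y = circle_of t" "z = circle_of u"
      by (metis circle_of_surj)
    obtain m :: int where m: "dist x z = \<bar>s - u - of_int m\<bar>"
      unfolding stu by (rule dist_circle_attained)
    obtain n :: int where n: "dist y z = \<bar>t - u - of_int n\<bar>"
      unfolding stu by (rule dist_circle_attained)
    have "dist x y \<le> \<bar>s - (t + of_int (m - n))\<bar>"
      using dist_circle_le[of s "t + of_int (m - n)"] stu by (simp only: circle_of_add_int)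
    also have "\<dots> \<le> dist x z + dist y z"
      unfolding m n by simp
    finally show ?thesis .
  qed
qed

end

lemma open_circle_iff: "open U \<longleftrightarrow> open (circle_of -` U)"
proof
  assume U: "open U"
  show "open (circle_of -` U)"
    unfolding open_dist
  proof
    fix s assume "s \<in> circle_of -` U"
    then obtain e where e: "e > 0" "\<And>y. dist y (circle_of s) < e \<Longrightarrow> y \<in> U"
      using U unfolding open_dist by auto
    show "\<exists>e>0. \<forall>t. dist t s < e \<longrightarrow> t \<in> circle_of -` U"
      using e dist_circle_le by (metis dist_real_def order_le_less_trans vimageI2)
  qed
next
  assume U: "open (circle_of -` U)"
  show "open U"
    unfolding open_dist
  proof
    fix x assume x: "x \<in> U"
    obtain s where s: "x = circle_of s" by (rule circle_of_surj)
    obtain e where e: "e > 0" "\<And>t. dist t s < e \<Longrightarrow> circle_of t \<in> U"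
      using U x s unfolding open_dist by auto
    have "y \<in> U" if y: "dist y x < e" for y
    proof -
      obtain t where t: "y = circle_of t" by (rule circle_of_surj)
      obtain n :: int where n: "dist y x = \<bar>t - s - of_int n\<bar>"
        unfolding s t by (rule dist_circle_attained)
      have "circle_of (t + of_int (- n)) \<in> U"
        by (rule e(2)) (use y n in \<open>simp add: dist_real_def algebra_simps\<close>)
      then show ?thesis
        unfolding t by (simp only: circle_of_add_int)
    qed
    with e(1) show "\<exists>e>0. \<forall>y. dist y x < e \<longrightarrow> y \<in> U" by blast
  qed
qed

section \<open>Piecewise continuous permutations\<close>

definition PC_hat :: "(circle \<Rightarrow> circle) monoid" where
  "PC_hat = (BijGroup UNIV)
     \<lparr>carrier := {f \<in> carrier (BijGroup UNIV). \<exists>F. finite F \<and> continuous_on (- F) f}\<rparr>"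

definition Sym_fin :: "(circle \<Rightarrow> circle) set" where
  "Sym_fin = {f \<in> carrier (BijGroup UNIV). finite {x. f x \<noteq> x}}"

definition PC :: "(circle \<Rightarrow> circle) set monoid" where
  "PC = PC_hat Mod Sym_fin"

definition PC_proj :: "(circle \<Rightarrow> circle) \<Rightarrow> (circle \<Rightarrow> circle) set" where
  "PC_proj f = Sym_fin #>\<^bsub>PC_hat\<^esub> f"

section \<open>Piecewise properties\<close>

text \<open>
  An open arc is given by a real interval \<open>{a<..<b}\<close> that maps onto it, and \<open>P a b f\<close> speaks
  about the restriction of \<open>f\<close> to that arc. The pieces are the arcs that avoid a
  finite set \<open>F\<close>.
\<close>

definition piecewise :: "(real \<Rightarrow> real \<Rightarrow> (circle \<Rightarrow> circle) \<Rightarrow> bool) \<Rightarrow> (circle \<Rightarrow> circle) \<Rightarrow> bool" where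
  "piecewise P f \<longleftrightarrow>
     (\<exists>F. finite F \<and> (\<forall>a b. a < b \<longrightarrow> circle_of ` {a<..<b} \<inter> F = {} \<longrightarrow> P a b f))"

text \<open>Orientation is read off from a continuous lift of \<open>f\<close> on the arc to a real function.\<close>

definition orientation_preserving_on_arc :: "real \<Rightarrow> real \<Rightarrow> (circle \<Rightarrow> circle) \<Rightarrow> bool" where
  "orientation_preserving_on_arc a b f \<longleftrightarrow>
     (\<exists>g :: real \<Rightarrow> real. continuous_on {a<..<b} g \<and> strict_mono_on {a<..<b} g \<and>
        (\<forall>s\<in>{a<..<b}. f (circle_of s) = circle_of (g s)))"

definition orientation_reversing_on_arc :: "real \<Rightarrow> real \<Rightarrow> (circle \<Rightarrow> circle) \<Rightarrow> bool" where
  "orientation_reversing_on_arc a b f \<longleftrightarrow>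
     (\<exists>g :: real \<Rightarrow> real. continuous_on {a<..<b} g \<and> strict_antimono_on {a<..<b} g \<and>
        (\<forall>s\<in>{a<..<b}. f (circle_of s) = circle_of (g s)))"

definition isometric_on_arc :: "real \<Rightarrow> real \<Rightarrow> (circle \<Rightarrow> circle) \<Rightarrow> bool" where
  "isometric_on_arc a b f \<longleftrightarrow>
     (\<forall>x \<in> circle_of ` {a<..<b}. \<forall>y \<in> circle_of ` {a<..<b}. dist (f x) (f y) = dist x y)"

text \<open>
  The \<open>piecewise\<close> properties are insensitive to changing \<open>f\<close> at finitely many points, so an
  element of \<open>PC\<close> has one of them as soon as some representative does.
\<close>

definition PC_plus :: "(circle \<Rightarrow> circle) set set" where
  "PC_plus = PC_proj ` {f \<in> carrier PC_hat. piecewise orientation_preserving_on_arc f}"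

definition PC_minus :: "(circle \<Rightarrow> circle) set set" where
  "PC_minus = PC_proj ` {f \<in> carrier PC_hat. piecewise orientation_reversing_on_arc f}"

definition PC_pm :: "(circle \<Rightarrow> circle) set set" where
  "PC_pm = PC_plus \<union> PC_minus"

definition IET_flip :: "(circle \<Rightarrow> circle) set set" where
  "IET_flip = PC_proj ` {f \<in> carrier PC_hat. piecewise isometric_on_arc f}"

definition IET_pm :: "(circle \<Rightarrow> circle) set set" where
  "IET_pm = PC_pm \<inter> IET_flip"

section \<open>Realizability\<close>

definition realizable :: "(circle \<Rightarrow> circle) set set \<Rightarrow> bool" where
  "realizable \<Gamma> \<longleftrightarrow> (\<exists>\<Lambda>. subgroup \<Lambda> PC_hat \<and> bij_betw PC_proj \<Lambda> \<Gamma>)"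

end

(*
  Take rotations by q and b with 1, q, b rationally independent, the flip x \<mapsto> -x, and one exchange g
  of two adjacent intervals. Since \<int>\<^sup>2 is one-ended, any lift of the two rotations is conjugate, by
  a finitely supported permutation, to the genuine rotations; after conjugation the flip is lifted
  genuinely as well. Commutation with disjoint rotated copies forces the lift of g to fix every
  point outside the support of g, and commutation with the mirror images in the two endpoints forces
  it to fix these too. But a rotation of the circle is a product of three rotated copies of g, and so
  its lift would fix the point 0.
*)

theory Submission
  imports Defs
begin

subsection \<open>The circle as a topological group\<close>

text \<open>One rotation would not be enough for rigidity: the map that fixes \<open>x\<close>,
  sends \<open>x - q\<close> to \<open>x + q\<close> and otherwise adds \<open>q\<close> is a
  permutation differing from \<open>rot q\<close> at two points, but it has a fixed point, so it is
  not conjugate to \<open>rot q\<close>. Commutation with a lift of \<open>rot b\<close> excludes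
  such defects.

  The bounds 1/4 < \<open>q\<close> < 1/3 keep the first exchanged interval nonempty and make the
  support arc [0, 1 - 2q] shorter than half a turn, which leaves room for disjoint rotated copies
  and for mirror images touching it in one endpoint. The interval lengths are chosen so that both
  displacements of the exchange, \<open>q\<close> and \<open>3q\<close> modulo 1, are positive
  multiples of \<open>q\<close>; this rules out finite invariant sets.

  The values of the lift inside the arc stay undetermined. The contradiction avoids them: evaluated
  at 0, the relation between the exchange and the rotation only visits 0, \<open>-q\<close> and
  \<open>-2q\<close>, that is, the two endpoints and one exterior point.\<close>

instantiation circle :: ab_group_add
begin

lift_definition zero_circle :: circle is "0 :: real" .

lift_definition plus_circle :: "circle \<Rightarrow> circle \<Rightarrow> circle" is "(+) :: real \<Rightarrow> real \<Rightarrow> real"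
  by (metis Ints_add add_diff_add)

lift_definition uminus_circle :: "circle \<Rightarrow> circle" is "uminus :: real \<Rightarrow> real"
  by (metis Ints_minus minus_diff_minus)

definition minus_circle :: "circle \<Rightarrow> circle \<Rightarrow> circle" where
  "x - y = x + - y" for x y :: circle

instance
  by standard (simp_all add: minus_circle_def, (transfer, simp)+)

end

lemma circle_of_0: "circle_of 0 = 0"
  and circle_of_add: "circle_of (s + t) = circle_of s + circle_of t"
  and circle_of_minus: "circle_of (- s) = - circle_of s"
  by (simp_all add: zero_circle.abs_eq plus_circle.abs_eq uminus_circle.abs_eq)

lemma circle_of_diff: "circle_of (s - t) = circle_of s - circle_of t"
  using circle_of_add[of s "- t"] by (simp add: circle_of_minus)

lemma circle_of_eq_0_iff: "circle_of s = 0 \<longleftrightarrow> s \<in> \<int>"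
  by (simp add: circle_of_eq_iff flip: circle_of_0)

lemma circle_of_int: "circle_of (of_int n) = 0"
  by (simp add: circle_of_eq_0_iff)

lemma circle_unit_rep:
  obtains s where "0 \<le> s" "s < 1" "x = circle_of s"
proof -
  obtain s where "x = circle_of s" by (rule circle_of_surj)
  then have "x = circle_of (frac s)"
    by (simp add: circle_of_eq_iff frac_def)
  with that show ?thesis
    using frac_ge_0 frac_lt_1 by blast
qed

lemma circle_of_inj:
  assumes "circle_of s = circle_of t" "\<bar>s - t\<bar> < 1"
  shows "s = t"
  using assms by (metis Ints_eq_abs_less1 Ints_0 abs_zero circle_of_eq_iff diff_0_right eq_iff_diff_eq_0 zero_less_one)

lemma inj_on_circle_of: "b - a \<le> 1 \<Longrightarrow> inj_on circle_of {a<..<b}"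
  by (rule inj_onI, rule circle_of_inj) auto

lemma circle_of_mem_image_iff:
  assumes "A \<subseteq> {0..<1}" "0 \<le> s" "s < 1"
  shows "circle_of s \<in> circle_of ` A \<longleftrightarrow> s \<in> A"
proof
  assume "circle_of s \<in> circle_of ` A"
  then obtain t where t: "t \<in> A" "circle_of s = circle_of t" by blast
  with assms have "s = t"
    by (intro circle_of_inj) (auto simp: abs_if)
  with t show "s \<in> A" by simp
qed blast

section \<open>The invariant metric and the local behaviour of the projection\<close>

lemma dist_circle_diff: "dist x y = dist (x - y) (0 :: circle)"
proof -
  obtain s t where st: "x = circle_of s" "y = circle_of t"
    by (metis circle_of_surj)
  obtain n :: int where n: "dist x y = \<bar>s - t - of_int n\<bar>"
    unfolding st by (rule dist_circle_attained)
  obtain m :: int where m: "dist (circle_of (s - t)) (circle_of 0) = \<bar>s - t - 0 - of_int m\<bar>"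
    by (rule dist_circle_attained)
  have "dist x y \<le> \<bar>s - t - of_int m\<bar>"
    using dist_circle_le[of s "t + of_int m"] by (simp add: st circle_of_add_int algebra_simps)
  moreover have "dist (circle_of (s - t)) (circle_of 0) \<le> \<bar>s - t - of_int n\<bar>"
    using dist_circle_le[of "s - t" "0 + of_int n"] by (simp only: circle_of_add_int)
  ultimately show ?thesis
    using n m by (simp add: st circle_of_diff circle_of_0)
qed

lemma dist_circle_add: "dist (x + a) (y + a) = dist x (y :: circle)"
  by (simp add: dist_circle_diff[of "x + a"] dist_circle_diff[of x])

lemma dist_circle_uminus: "dist (- x) (- y) = dist x (y :: circle)"
  by (metis dist_circle_diff dist_commute minus_diff_eq minus_diff_minus)

text \<open>Half a turn is the sharp bound: beyond it, another integer shift brings the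
  representatives closer.\<close>

lemma dist_circle_of:
  assumes "\<bar>s - t\<bar> \<le> 1 / 2"
  shows "dist (circle_of s) (circle_of t) = \<bar>s - t\<bar>"
proof (rule antisym)
  obtain n :: int where n: "dist (circle_of s) (circle_of t) = \<bar>s - t - of_int n\<bar>"
    by (rule dist_circle_attained)
  have "n = 0 \<or> \<bar>real_of_int n\<bar> \<ge> 1"
    by (metis of_int_eq_0_iff Ints_eq_abs_less1 Ints_0 Ints_of_int diff_0_right linorder_not_less)
  with assms show "\<bar>s - t\<bar> \<le> dist (circle_of s) (circle_of t)"
    unfolding n by linarith
qed (rule dist_circle_le)

lemma continuous_on_circle_of: "continuous_on S circle_of"
  unfolding continuous_on_iff by (metis dist_circle_le dist_real_def order_le_less_trans)

lemma continuous_on_circle_translation: "continuous_on S (\<lambda>x :: circle. x + a)"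
  unfolding continuous_on_iff by (metis dist_circle_add)

lemma continuous_on_circle_uminus: "continuous_on S (uminus :: circle \<Rightarrow> circle)"
  unfolding continuous_on_iff by (metis dist_circle_uminus)

text \<open>The saturation of \<open>U\<close> is the union of its integer translates.\<close>

lemma open_map_circle_of:
  assumes "open U"
  shows "open (circle_of ` U)"
proof -
  have "circle_of -` circle_of ` U = (\<Union>n::int. (+) (of_int n) ` U)" (is "?L = ?R")
  proof (rule Set.set_eqI)
    fix t
    show "t \<in> ?L \<longleftrightarrow> t \<in> ?R"
    proof
      assume "t \<in> ?L"
      then obtain s where s: "s \<in> U" "t - s \<in> \<int>" by (auto simp: circle_of_eq_iff)
      then obtain n :: int where "t - s = of_int n" by (auto elim: Ints_cases)
      then have "t = of_int n + s" by simp
      with s show "t \<in> ?R" by blast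
    next
      assume "t \<in> ?R"
      then obtain n :: int and s where "s \<in> U" "t = of_int n + s" by blast
      then show "t \<in> ?L"
        by (metis add.commute circle_of_add_int image_eqI vimageI2)
    qed
  qed
  moreover have "open ?R"
    using assms by (intro open_UN ballI open_translation)
  ultimately show ?thesis by (simp add: open_circle_iff)
qed

subsection \<open>Inverses of piecewise continuous permutations\<close>

text \<open>On an arc of length \<open>1/2\<close> the projection \<open>circle_of\<close> is isometric, which gives
  continuous local lifts.\<close>

lemma local_lift:
  assumes "continuous_on U f" "open U" "circle_of s \<in> U"
  obtains h :: "real \<Rightarrow> real" and d where "d > 0" "d \<le> 1 / 2" "continuous_on {s - d<..<s + d} h"
    "\<And>t. t \<in> {s - d<..<s + d} \<Longrightarrow> circle_of t \<in> U \<and> f (circle_of t) = circle_of (h t)"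
proof -
  define V where "V = {s. circle_of s \<in> U}"
  have V: "open V"
    using assms(2) unfolding open_circle_iff V_def vimage_def by simp
  have cont: "continuous_on V (\<lambda>t. f (circle_of t))"
    by (rule continuous_on_compose2[OF assms(1) continuous_on_circle_of]) (auto simp: V_def)
  have sV: "s \<in> V" using assms(3) by (simp add: V_def)
  obtain d1 where d1: "d1 > 0" "\<And>t. dist t s < d1 \<Longrightarrow> t \<in> V"
    using V sV unfolding open_dist by blast
  \<comment> \<open>Lifts chosen within 1/4 of \<open>u\<close> are within 1/2 of each other, where
    \<open>circle_of\<close> preserves distances; so \<open>h\<close> inherits continuity from
    \<open>f\<close>.\<close>
  obtain d2 where d2: "d2 > 0"
    "\<And>t. t \<in> V \<Longrightarrow> dist t s < d2 \<Longrightarrow> dist (f (circle_of t)) (f (circle_of s)) < 1 / 4"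
    using cont sV unfolding continuous_on_iff by (metis zero_less_divide_1_iff zero_less_numeral)
  \<comment> \<open>The cap 1/2 makes the window at most one turn long, so that
    \<open>circle_of\<close> is injective on it.\<close>
  define d where "d = min (1 / 2) (min d1 d2)"
  obtain u where u: "f (circle_of s) = circle_of u" by (rule circle_of_surj)
  have "\<exists>r. f (circle_of t) = circle_of r \<and> \<bar>r - u\<bar> < 1 / 4" if "t \<in> {s - d<..<s + d}" for t
  proof -
    have "dist t s < d" using that by (auto simp: dist_real_def)
    then have *: "dist (f (circle_of t)) (circle_of u) < 1 / 4"
      using d1 d2 u by (simp add: d_def)
    obtain r where r: "f (circle_of t) = circle_of r" by (rule circle_of_surj)
    obtain n :: int where "dist (circle_of r) (circle_of u) = \<bar>r - u - of_int n\<bar>"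
      by (rule dist_circle_attained)
    moreover have "circle_of r = circle_of (r + of_int (- n))"
      by (simp only: circle_of_add_int)
    ultimately show ?thesis using * r by (intro exI[of _ "r + of_int (- n)"]) (simp add: algebra_simps)
  qed
  then obtain h where h: "\<And>t. t \<in> {s - d<..<s + d} \<Longrightarrow> f (circle_of t) = circle_of (h t) \<and> \<bar>h t - u\<bar> < 1 / 4"
    by metis
  show ?thesis
  proof (rule that)
    show "d > 0" "d \<le> 1 / 2" using d1 d2 by (auto simp: d_def)
    have sub: "{s - d<..<s + d} \<subseteq> V"
      using d1 by (auto simp: d_def dist_real_def)
    show "circle_of t \<in> U \<and> f (circle_of t) = circle_of (h t)" if "t \<in> {s - d<..<s + d}" for t
      using h[OF that] sub that by (auto simp: V_def)
    have eq: "dist (h t) (h t') = dist (f (circle_of t)) (f (circle_of t'))"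
      if "t \<in> {s - d<..<s + d}" "t' \<in> {s - d<..<s + d}" for t t'
    proof -
      have "\<bar>h t - h t'\<bar> \<le> 1 / 2" using h[OF that(1)] h[OF that(2)] by linarith
      then show ?thesis
        using h that by (simp add: dist_real_def dist_circle_of)
    qed
    show "continuous_on {s - d<..<s + d} h"
      using continuous_on_subset[OF cont sub] unfolding continuous_on_iff
      by (metis eq)
  qed
qed

text \<open>A local lift is injective because \<open>f\<close> and \<open>circle_of\<close> are, so
  invariance of domain applies to it on the real line; the projection carries openness back to the
  circle.\<close>

lemma open_image_injective_circle:
  fixes f :: "circle \<Rightarrow> circle"
  assumes "continuous_on U f" "open U" "inj_on f U"
  shows "open (f ` U)"
proof (subst open_subopen, intro ballI)
  fix y assume "y \<in> f ` U"
  then obtain s where s: "circle_of s \<in> U" "y = f (circle_of s)"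
    by (metis circle_of_surj imageE)
  obtain h d where d: "d > 0" "d \<le> 1 / 2" and h: "continuous_on {s - d<..<s + d} h"
    "\<And>t. t \<in> {s - d<..<s + d} \<Longrightarrow> circle_of t \<in> U \<and> f (circle_of t) = circle_of (h t)"
    using local_lift[OF assms(1,2) s(1)] by metis
  let ?J = "{s - d<..<s + d}"
  have "inj_on h ?J"
  proof (rule inj_onI)
    fix t t' assume t: "t \<in> ?J" "t' \<in> ?J" "h t = h t'"
    then have "circle_of t = circle_of t'"
      using h(2) assms(3) by (metis inj_onD)
    with t d show "t = t'" by (intro circle_of_inj) auto
  qed
  then have "open (h ` ?J)"
    using h(1) by (intro invariance_of_domain) auto
  then have "open (circle_of ` h ` ?J)" by (rule open_map_circle_of)
  moreover have "circle_of ` h ` ?J \<subseteq> f ` U"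
  proof clarify
    fix t assume "t \<in> ?J"
    from h(2)[OF this] show "circle_of (h t) \<in> f ` U" by (metis imageI)
  qed
  moreover have "y \<in> circle_of ` h ` ?J"
  proof -
    have "s \<in> ?J" using d by simp
    with h(2)[OF this] s(2) show ?thesis by (metis imageI)
  qed
  ultimately show "\<exists>T. open T \<and> y \<in> T \<and> T \<subseteq> f ` U" by blast
qed

text \<open>Continuity of the inverse is openness of \<open>f\<close> off the exceptional set. This
  gives \<open>PC_hat\<close> its inverses.\<close>

lemma continuous_on_inv_cofinite:
  fixes f :: "circle \<Rightarrow> circle"
  assumes "bij f" "finite F" "continuous_on (- F) f"
  shows "continuous_on (- f ` F) (inv_into UNIV f)"
proof -
  have o: "open (- F)" "open (- f ` F)" using assms(2) by (simp_all add: finite_imp_closed open_Compl)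
  show ?thesis
    unfolding continuous_on_open_vimage[OF o(2)]
  proof (intro allI impI)
    fix V :: "circle set" assume V: "open V"
    have "inv_into UNIV f -` V = f ` V"
      using assms(1) by (simp add: bij_vimage_eq_inv_image bij_imp_bij_inv inv_inv_eq)
    then have "inv_into UNIV f -` V \<inter> - f ` F = f ` (V \<inter> - F)"
      using assms(1) by (simp add: bij_is_inj image_Int bij_image_Compl_eq)
    moreover have "open (f ` (V \<inter> - F))"
      using assms V o by (intro open_image_injective_circle)
        (auto intro: continuous_on_subset open_Int simp: bij_is_inj inj_on_subset[OF bij_is_inj])
    ultimately show "open (inv_into UNIV f -` V \<inter> - f ` F)" by simp
  qed
qed

subsection \<open>Rigidity of lifted irrational rotations\<close>

text \<open>On \<open>PC_hat\<close> this is equality in the quotient \<open>PC\<close>. Stated for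
  plain functions, it keeps cosets out of the dynamical argument.\<close>

definition nearly_eq :: "('a \<Rightarrow> 'b) \<Rightarrow> ('a \<Rightarrow> 'b) \<Rightarrow> bool" where
  "nearly_eq f g \<longleftrightarrow> finite {x. f x \<noteq> g x}"

lemma nearly_eq_refl [simp]: "nearly_eq f f"
  by (simp add: nearly_eq_def)

lemma nearly_eq_sym: "nearly_eq f g \<Longrightarrow> nearly_eq g f"
  by (simp add: nearly_eq_def eq_commute)

lemma nearly_eq_trans:
  assumes "nearly_eq f g" "nearly_eq g h"
  shows "nearly_eq f h"
  using assms unfolding nearly_eq_def
  by (rule finite_subset[rotated, OF finite_UnI]) auto

text \<open>Injectivity of \<open>g\<close> keeps the preimage of the exceptional set of
  \<open>f\<close> finite.\<close>

lemma nearly_eq_comp: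
  assumes "nearly_eq f f'" "nearly_eq g g'" "inj g"
  shows "nearly_eq (f \<circ> g) (f' \<circ> g')"
proof -
  have "finite (g -` {x. f x \<noteq> f' x} \<union> {x. g x \<noteq> g' x})"
    using assms by (intro finite_UnI finite_vimageI) (auto simp: nearly_eq_def)
  then show ?thesis
    unfolding nearly_eq_def by (rule rev_finite_subset) auto
qed

definition rot :: "real \<Rightarrow> circle \<Rightarrow> circle" where
  "rot t x = x + circle_of t"

lemma bij_rot: "bij (rot t)"
  unfolding rot_def by (rule bij_betwI[of _ _ _ "\<lambda>x. x - circle_of t"]) auto

lemma rot_comp: "rot s \<circ> rot t = rot (s + t)"
  by (auto simp: rot_def circle_of_add add_ac)

lemma bij_uminus_circle: "bij (uminus :: circle \<Rightarrow> circle)"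
  by (rule bij_betwI[of _ _ _ uminus]) auto

lemma multiple_eq_iff:
  assumes "q \<notin> \<rat>"
  shows "circle_of (of_int m * q) = circle_of (of_int n * q) \<longleftrightarrow> m = n"
proof
  assume "circle_of (of_int m * q) = circle_of (of_int n * q)"
  then obtain k :: int where k: "of_int (m - n) * q = of_int k"
    by (auto simp: circle_of_eq_iff algebra_simps elim: Ints_cases)
  show "m = n"
  proof (rule ccontr)
    assume "m \<noteq> n"
    with k have "q = of_int k / of_int (m - n)" by (simp add: field_simps)
    with assms show False by (metis Rats_divide Rats_of_int)
  qed
qed simp

text \<open>An irrational orbit never repeats a point, so it visits each point of \<open>F\<close>
  at most once.\<close>

lemma multiple_eventually_avoids:
  fixes q :: real
  assumes "q \<notin> \<rat>" "finite F"
  shows "\<exists>N. \<forall>n\<ge>N. y + circle_of (real n * q) \<notin> F"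
proof -
  have "inj (\<lambda>n. y + circle_of (real n * q))"
    using multiple_eq_iff[OF assms(1), of "int _" "int _"] by (auto intro!: injI)
  then have "finite ((\<lambda>n. y + circle_of (real n * q)) -` F)"
    using assms(2) by (intro finite_vimageI)
  then obtain N where "\<forall>n\<in>(\<lambda>n. y + circle_of (real n * q)) -` F. n < N"
    using finite_nat_set_iff_bounded by blast
  then show ?thesis by (metis linorder_not_less vimageI)
qed

text \<open>The conjugating map is \<open>y \<mapsto> A\<^sup>-\<^sup>n (y + nq)\<close> for large \<open>n\<close>. A point \<open>y\<close> that it moves has
  \<open>y + nq\<close> in the exceptional set of \<open>A\<close> for some \<open>n\<close>. Commutation with \<open>B\<close> propagates this
  along \<open>y, y + b, y + 2b, \<dots>\<close> until the exceptional set of \<open>B\<close> is met, and by independence of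
  \<open>q\<close> and \<open>b\<close> this can happen only boundedly often.\<close>

lemma commuting_rotations_rigid:
  fixes A B :: "circle \<Rightarrow> circle"
  assumes bij: "bij A" "bij B" and comm: "A \<circ> B = B \<circ> A"
    and near: "nearly_eq A (rot q)" "nearly_eq B (rot b)"
    and indep: "\<And>m k :: int. of_int m * q + of_int k * b \<in> \<int> \<Longrightarrow> m = 0 \<and> k = 0"
  obtains \<psi> where "bij \<psi>" "nearly_eq \<psi> id" "A \<circ> \<psi> = \<psi> \<circ> rot q"
proof -
  have irr: "q \<notin> \<rat>"
  proof
    assume "q \<in> \<rat>"
    then obtain i j :: int where "j > 0" "q = of_int i / of_int j"
      by (metis Rats_cases')
    then have "of_int j * q + of_int 0 * b = of_int i" by simp
    with indep[of j 0] \<open>j > 0\<close> show False by (metis Ints_of_int less_irrefl)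
  qed
  let ?c = "\<lambda>n::nat. circle_of (real n * q)"
  have c_Suc: "?c (Suc n) = ?c n + circle_of q" for n
    by (simp add: algebra_simps flip: circle_of_add)
  define FA where "FA = {x. A x \<noteq> x + circle_of q}"
  define FB where "FB = {x. B x \<noteq> x + circle_of b}"
  have fin: "finite FA" "finite FB"
    using near by (simp_all add: nearly_eq_def rot_def FA_def FB_def)
  have An: "bij (A ^^ n)" for n
    using bij(1) by (rule bij_fn)
  have AnB: "(A ^^ n) (B x) = B ((A ^^ n) x)" for n x
    using comm by (induction n) (simp_all add: fun_eq_iff)
  have follow: "(A ^^ n) x = x + ?c n" if "\<And>i. i < n \<Longrightarrow> x + ?c i \<notin> FA" for n x
    using that
  proof (induction n)
    case 0
    then show ?case by (simp add: circle_of_0)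
  next
    case (Suc n)
    then have "x + ?c n \<notin> FA" by simp
    then show ?case using Suc unfolding c_Suc by (simp add: FA_def add_ac)
  qed
  \<comment> \<open>Once the orbit of \<open>y\<close> has left \<open>FA\<close> for good, pulling
    back \<open>y + nq\<close> by the \<open>n\<close>th power of \<open>A\<close> gives the same
    \<open>x\<close> for all larger \<open>n\<close>.\<close>
  have "\<exists>x N. \<forall>n\<ge>N. (A ^^ n) x = y + ?c n" for y
  proof -
    obtain N where N: "\<forall>n\<ge>N. y + ?c n \<notin> FA"
      using multiple_eventually_avoids[OF irr fin(1)] by blast
    obtain x where x: "(A ^^ N) x = y + ?c N"
      using An by (metis bij_pointE)
    have "(A ^^ (N + k)) x = y + ?c (N + k)" for k
    proof (induction k)
      case (Suc k)
      have "y + ?c (N + k) \<notin> FA" using N le_add1 by blast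
      then have "A (y + ?c (N + k)) = y + ?c (Suc (N + k))"
        unfolding c_Suc by (simp add: FA_def add_ac)
      with Suc show ?case by simp
    qed (use x in simp)
    then show ?thesis by (metis le_add_diff_inverse)
  qed
  then obtain \<psi> where \<psi>: "\<And>y. \<exists>N. \<forall>n\<ge>N. (A ^^ n) (\<psi> y) = y + ?c n"
    by metis
  \<comment> \<open>With uniqueness, each identity for \<open>\<psi>\<close> becomes a check for
    large \<open>n\<close> only, when the exceptional sets have been left.\<close>
  have uniq: "\<psi> y = x" if x: "\<exists>N. \<forall>n\<ge>N. (A ^^ n) x = y + ?c n" for x y
  proof -
    obtain N M where "\<forall>n\<ge>N. (A ^^ n) x = y + ?c n" "\<forall>n\<ge>M. (A ^^ n) (\<psi> y) = y + ?c n"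
      using \<psi> x by blast
    then have "(A ^^ max N M) (\<psi> y) = (A ^^ max N M) x" by simp
    then show ?thesis by (rule injD[OF bij_is_inj[OF An]])
  qed
  have inj: "inj \<psi>"
  proof (rule injI)
    fix y y' assume eq: "\<psi> y = \<psi> y'"
    obtain N M where "\<forall>n\<ge>N. (A ^^ n) (\<psi> y) = y + ?c n" "\<forall>n\<ge>M. (A ^^ n) (\<psi> y') = y' + ?c n"
      using \<psi> by blast
    with eq have "y + ?c (max N M) = y' + ?c (max N M)" by (metis max.cobounded1 max.cobounded2)
    then show "y = y'" by simp
  qed
  have \<psi>A: "\<psi> (y + circle_of q) = A (\<psi> y)" for y
  proof (rule uniq)
    obtain N where N: "\<forall>n\<ge>N. (A ^^ n) (\<psi> y) = y + ?c n" using \<psi> by blast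
    have "(A ^^ n) (A (\<psi> y)) = y + circle_of q + ?c n" if "n \<ge> N" for n
      using N[rule_format, of "Suc n"] that unfolding c_Suc
      by (simp add: funpow_swap1 add_ac)
    then show "\<exists>N. \<forall>n\<ge>N. (A ^^ n) (A (\<psi> y)) = y + circle_of q + ?c n" by blast
  qed
  have \<psi>B: "\<psi> (y + circle_of b) = B (\<psi> y)" for y
  proof (rule uniq)
    obtain N where N: "\<forall>n\<ge>N. (A ^^ n) (\<psi> y) = y + ?c n" using \<psi> by blast
    obtain M where M: "\<forall>n\<ge>M. y + ?c n \<notin> FB"
      using multiple_eventually_avoids[OF irr fin(2)] by blast
    have "(A ^^ n) (B (\<psi> y)) = y + circle_of b + ?c n" if "n \<ge> max N M" for n
    proof -
      have "(A ^^ n) (B (\<psi> y)) = B (y + ?c n)" using N that by (simp add: AnB)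
      also have "\<dots> = y + ?c n + circle_of b" using M that by (simp add: FB_def)
      finally show ?thesis by (simp add: add_ac)
    qed
    then show "\<exists>N. \<forall>n\<ge>N. (A ^^ n) (B (\<psi> y)) = y + circle_of b + ?c n" by blast
  qed
  define D where "D = {y. \<psi> y \<noteq> y}"
  have D_FA: "\<exists>n. y + ?c n \<in> FA" if "y \<in> D" for y
  proof (rule ccontr)
    assume "\<nexists>n. y + ?c n \<in> FA"
    then have "(A ^^ n) y = y + ?c n" for n by (intro follow) auto
    then have "\<psi> y = y" by (intro uniq) simp
    with that show False by (simp add: D_def)
  qed
  have D_step: "y + circle_of b \<in> D" if "y \<in> D" "y \<notin> FB" for y
  proof (rule ccontr)
    assume "y + circle_of b \<notin> D"
    then have "B (\<psi> y) = B y"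
      using that \<psi>B[of y] by (simp add: D_def FB_def)
    then show False using bij_is_inj[OF bij(2)] that by (simp add: D_def inj_eq)
  qed
  let ?b = "\<lambda>k::nat. circle_of (real k * b)"
  \<comment> \<open>If \<open>FB\<close> were avoided for k = 0, ..., \<open>card FA\<close>, each
    of these \<open>card FA + 1\<close> points would run into \<open>FA\<close> along its
    \<open>q\<close>-orbit, at pairwise different places by independence: one too many.\<close>
  have D_FB: "\<exists>k\<le>card FA. y + ?b k \<in> FB" if y: "y \<in> D" for y
  proof (rule ccontr)
    assume no: "\<not> ?thesis"
    have "y + ?b k \<in> D" if "k \<le> card FA" for k
      using that
    proof (induction k)
      case 0
      then show ?case using y by (simp add: circle_of_0)
    next
      case (Suc k)
      then have "y + ?b k + circle_of b \<in> D" using no by (intro D_step) auto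
      then show ?case by (simp add: algebra_simps flip: circle_of_add)
    qed
    then have "\<forall>k\<in>{..card FA}. \<exists>n. y + ?b k + ?c n \<in> FA" using D_FA by blast
    then obtain n where n: "\<And>k. k \<le> card FA \<Longrightarrow> y + ?b k + ?c (n k) \<in> FA" by (metis atMost_iff)
    have "inj_on (\<lambda>k. y + ?b k + ?c (n k)) {..card FA}"
    proof (rule inj_onI)
      fix i j assume "y + ?b i + ?c (n i) = y + ?b j + ?c (n j)"
      then have "circle_of (real i * b + real (n i) * q) = circle_of (real j * b + real (n j) * q)"
        by (simp add: circle_of_add add.assoc)
      then have "of_int (int (n i) - int (n j)) * q + of_int (int i - int j) * b \<in> \<int>"
        by (simp add: circle_of_eq_iff algebra_simps)
      from indep[OF this] show "i = j" by simp
    qed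
    then have "card {..card FA} \<le> card FA"
      using n fin(1) by (intro card_inj_on_le) auto
    then show False by simp
  qed
  have "finite (\<Union>k\<in>{..card FA}. (\<lambda>y. y - ?b k) ` FB)" using fin(2) by simp
  moreover have "D \<subseteq> (\<Union>k\<in>{..card FA}. (\<lambda>y. y - ?b k) ` FB)"
  proof
    fix y assume "y \<in> D"
    then obtain k where "k \<le> card FA" "y + ?b k \<in> FB" using D_FB by blast
    moreover have "y = y + ?b k - ?b k" by simp
    ultimately show "y \<in> (\<Union>k\<in>{..card FA}. (\<lambda>y. y - ?b k) ` FB)" by blast
  qed
  ultimately have D: "finite D" by (rule rev_finite_subset)
  \<comment> \<open>Off \<open>D\<close> the map is the identity, so surjectivity only concerns the
    finite set \<open>D\<close>, where injectivity yields it.\<close>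
  have "\<psi> ` D = D"
  proof (rule endo_inj_surj[OF D])
    show "\<psi> ` D \<subseteq> D" using inj by (auto simp: D_def inj_eq)
    show "inj_on \<psi> D" using inj by (rule inj_on_subset) simp
  qed
  then have "surj \<psi>" unfolding D_def surj_def by (auto simp: set_eq_iff image_iff) (metis)
  then show ?thesis
    using that inj D \<psi>A by (auto simp: bij_def nearly_eq_def D_def fun_eq_iff rot_def)
qed

subsection \<open>An interval exchange\<close>

text \<open>The exchange of the adjacent intervals \<open>[0, 1 - 3q)\<close> and \<open>[1 - 3q, 1 - 2q)\<close>, of lengths
  \<open>1 - 3q\<close> and \<open>q\<close>; the translation of the second one by \<open>-(1 - 3q)\<close> is \<open>3q\<close> modulo \<open>1\<close>.\<close>

definition exchange :: "real \<Rightarrow> circle \<Rightarrow> circle" where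
  "exchange q x =
     (if x \<in> circle_of ` {0..<1 - 3 * q} then x + circle_of q
      else if x \<in> circle_of ` {1 - 3 * q..<1 - 2 * q} then x + circle_of (3 * q)
      else x)"

context
  fixes q :: real
  assumes q: "1 / 4 < q" "q < 1 / 3"
begin

lemma exchange_left:
  assumes "0 \<le> s" "s < 1 - 3 * q"
  shows "exchange q (circle_of s) = circle_of (s + q)"
  using assms by (auto simp: exchange_def circle_of_add)

lemma exchange_right:
  assumes "1 - 3 * q \<le> s" "s < 1 - 2 * q"
  shows "exchange q (circle_of s) = circle_of (s + 3 * q - 1)"
proof -
  have "circle_of s \<notin> circle_of ` {0..<1 - 3 * q}"
    using assms q by (subst circle_of_mem_image_iff) auto
  moreover have "circle_of s \<in> circle_of ` {1 - 3 * q..<1 - 2 * q}"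
    using assms by simp
  moreover have "circle_of (s + 3 * q - 1) = circle_of (s + 3 * q)"
    by (simp add: circle_of_eq_iff)
  ultimately show ?thesis by (simp add: exchange_def circle_of_add)
qed

lemma exchange_outside:
  assumes "1 - 2 * q \<le> s" "s < 1"
  shows "exchange q (circle_of s) = circle_of s"
  using assms q by (simp add: exchange_def circle_of_mem_image_iff)

text \<open>The exterior in negative coordinates, the form in which wrapped-around points turn up
  below.\<close>

lemma exchange_outside':
  assumes "- 2 * q \<le> s" "s < 0"
  shows "exchange q (circle_of s) = circle_of s"
proof -
  have "circle_of s = circle_of (s + 1)" by (simp add: circle_of_eq_iff)
  with assms exchange_outside[of "s + 1"] show ?thesis by simp
qed

text \<open>Moving the block \<open>[0, 1 - 3q)\<close> past three consecutive blocks of length \<open>q\<close> is a rotation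
  of the circle; each of the three moves is a rotated copy of \<open>exchange q\<close>.\<close>

lemma exchange_rot_relation:
  "exchange q (rot (- q) (exchange q (rot (- q) (exchange q x)))) = rot q x"
proof -
  obtain s where s: "0 \<le> s" "s < 1" "x = circle_of s" by (rule circle_unit_rep)
  have r: "rot t (circle_of u) = circle_of (u + t)" for t u
    by (simp add: rot_def circle_of_add)
  have wrap: "circle_of (s + q - 1) = circle_of (s + q)"
    by (simp add: circle_of_eq_iff)
  \<comment> \<open>Either the point belongs to the short block, which takes part in all three
    moves, or it lies in the block of length \<open>q\<close> overtaken by the first, second or
    third move.\<close>
  consider "s < 1 - 3 * q" | "1 - 3 * q \<le> s" "s < 1 - 2 * q" | "1 - 2 * q \<le> s" "s < 1 - q" | "1 - q \<le> s"
    by linarith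
  then show ?thesis
  proof cases
    case 1
    then show ?thesis using s by (simp add: exchange_left r)
  next
    case 2
    have "exchange q x = circle_of (s + 3 * q - 1)"
      using 2 s by (simp add: exchange_right)
    moreover have "exchange q (rot (- q) \<dots>) = circle_of (s + 2 * q - 1)"
      using 2 q unfolding r by (subst exchange_outside') (auto simp: algebra_simps)
    moreover have "exchange q (rot (- q) \<dots>) = circle_of (s + q - 1)"
      using 2 q unfolding r by (subst exchange_outside') (auto simp: algebra_simps)
    ultimately show ?thesis using wrap s by (simp add: r)
  next
    case 3
    have "exchange q x = circle_of s"
      using 3 s by (simp add: exchange_outside)
    moreover have "exchange q (rot (- q) \<dots>) = circle_of (s + 2 * q - 1)"
      using 3 q unfolding r by (subst exchange_right) (auto simp: algebra_simps)
    moreover have "exchange q (rot (- q) \<dots>) = circle_of (s + q - 1)"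
      using 3 q unfolding r by (subst exchange_outside') (auto simp: algebra_simps)
    ultimately show ?thesis using wrap s by (simp add: r)
  next
    case 4
    have "exchange q x = circle_of s"
      using 4 s q by (simp add: exchange_outside)
    moreover have "exchange q (rot (- q) \<dots>) = circle_of (s - q)"
      using 4 s q unfolding r by (subst exchange_outside) auto
    moreover have "exchange q (rot (- q) \<dots>) = circle_of (s + q - 1)"
      using 4 s q unfolding r by (subst exchange_right) (auto simp: algebra_simps)
    ultimately show ?thesis using wrap s by (simp add: r)
  qed
qed

text \<open>The rotation is bijective, so in the relation above the innermost exchange must be
  injective and the outermost one surjective.\<close>

lemma bij_exchange: "bij (exchange q)"
proof (rule bijI)
  show "inj (exchange q)"
  proof (rule injI)
    fix x y assume "exchange q x = exchange q y"
    then have "rot q x = rot q y" by (metis exchange_rot_relation)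
    then show "x = y" by (simp add: rot_def)
  qed
  show "surj (exchange q)"
    using exchange_rot_relation by (metis bij_rot bij_pointE surj_def)
qed

lemma exchange_disp: "exchange q x - x \<in> {0, circle_of q, circle_of (3 * q)}"
  by (simp add: exchange_def)

text \<open>Invariance of the half-open arc and strictly forward steps, with j = 1 or j = 3, are the
  input for \<open>no_finite_forward_orbit\<close>.\<close>

lemma exchange_interior:
  assumes "x \<in> circle_of ` {0..<1 - 2 * q}"
  shows "exchange q x \<in> circle_of ` {0..<1 - 2 * q}"
    "\<exists>j::nat>0. exchange q x = x + circle_of (real j * q)"
proof -
  obtain s where s: "0 \<le> s" "s < 1 - 2 * q" "x = circle_of s"
    using assms by auto
  then consider "s < 1 - 3 * q" | "1 - 3 * q \<le> s" by linarith
  then show "exchange q x \<in> circle_of ` {0..<1 - 2 * q}"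
  proof cases
    case 1
    then show ?thesis using s q unfolding s(3) by (subst exchange_left) auto
  next
    case 2
    then show ?thesis using s q unfolding s(3) by (subst exchange_right) auto
  qed
  have "exchange q x = x + circle_of (real 1 * q) \<or> exchange q x = x + circle_of (real 3 * q)"
    using assms s by (cases "s < 1 - 3 * q") (auto simp: exchange_def)
  then show "\<exists>j::nat>0. exchange q x = x + circle_of (real j * q)"
    by (metis zero_less_one zero_less_numeral of_nat_1 of_nat_numeral)
qed

lemma exchange_exterior:
  assumes "x \<notin> circle_of ` {0..1 - 2 * q}"
  shows "exchange q x = x"
  using assms q by (auto simp: exchange_def image_iff)

text \<open>The three breakpoints cut the circle into open arcs, on each of which the map is a
  translation.\<close>

lemma continuous_on_exchange:
  "continuous_on (- circle_of ` {0, 1 - 3 * q, 1 - 2 * q}) (exchange q)"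
proof -
  let ?U = "\<lambda>i::nat. circle_of ` (if i = 0 then {0<..<1 - 3 * q} else
              if i = 1 then {1 - 3 * q<..<1 - 2 * q} else {1 - 2 * q<..<1})"
  have "continuous_on (\<Union>i\<in>{0,1,2}. ?U i) (exchange q)"
  proof (rule continuous_on_open_UN)
    fix i :: nat assume "i \<in> {0,1,2}"
    show "open (?U i)" by (intro open_map_circle_of) simp
    have "\<exists>a. \<forall>x\<in>?U i. exchange q x = x + a"
    proof (cases "i \<in> {0,1}")
      case True
      then show ?thesis
      proof (elim insertE emptyE)
        assume "i = 0"
        then show ?thesis by (intro exI[of _ "circle_of q"]) (auto simp: exchange_left circle_of_add)
      next
        assume "i = 1"
        then show ?thesis
          by (intro exI[of _ "circle_of (3 * q - 1)"])
            (auto simp: exchange_right add_diff_eq simp flip: circle_of_add)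
      qed
    next
      case False
      then show ?thesis by (intro exI[of _ 0]) (auto simp: exchange_outside)
    qed
    then obtain a where "\<And>x. x \<in> ?U i \<Longrightarrow> exchange q x = x + a" by blast
    then show "continuous_on (?U i) (exchange q)"
      using continuous_on_circle_translation by (metis (no_types, lifting) continuous_on_cong)
  qed
  moreover have "- circle_of ` {0, 1 - 3 * q, 1 - 2 * q} \<subseteq> (\<Union>i\<in>{0,1,2}. ?U i)"
  proof
    fix x assume x: "x \<in> - circle_of ` {0, 1 - 3 * q, 1 - 2 * q}"
    obtain s where s: "0 \<le> s" "s < 1" "x = circle_of s" by (rule circle_unit_rep)
    with x have "s \<notin> {0, 1 - 3 * q, 1 - 2 * q}" by blast
    with s have "s \<in> {0<..<1 - 3 * q} \<or> s \<in> {1 - 3 * q<..<1 - 2 * q} \<or> s \<in> {1 - 2 * q<..<1}"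
      by auto
    with s show "x \<in> (\<Union>i\<in>{0,1,2}. ?U i)" by auto
  qed
  ultimately show ?thesis by (rule continuous_on_subset)
qed

end

subsection \<open>Obstruction to realizing the interval exchange\<close>

text \<open>By Kronecker approximation the multiples of \<open>q\<close> are dense modulo 1.
  Infinitely many are wanted because finitely many bad rotations will have to be avoided.\<close>

lemma infinite_dense_rotations:
  fixes q lo hi :: real
  assumes "q \<notin> \<rat>" "0 \<le> lo" "lo < hi" "hi \<le> 1"
  shows "infinite {t \<in> {lo<..<hi}. \<exists>k m :: int. t = of_int k * q + of_int m}" (is "infinite ?T")
proof
  assume fin: "finite ?T"
  \<comment> \<open>Below the least element of a finite \<open>?T\<close> there is still a gap to
    hit; inserting \<open>hi\<close> covers the case that \<open>?T\<close> is empty.\<close>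
  define hi' where "hi' = Min (insert hi ?T)"
  have hi': "lo < hi'" "hi' \<le> hi" using fin assms by (auto simp: hi'_def)
  obtain k :: nat where "\<bar>frac (real k * q) - (lo + hi') / 2\<bar> < (hi' - lo) / 2"
    using Kronecker_approx_1_explicit[OF assms(1), of "(lo + hi') / 2" "(hi' - lo) / 2"] assms hi'
    by auto
  then have "lo < frac (real k * q)" "frac (real k * q) < hi'"
    by (auto simp: abs_less_iff field_simps)
  moreover have "frac (real k * q) = of_int (int k) * q + of_int (- \<lfloor>real k * q\<rfloor>)"
    by (simp add: frac_def)
  ultimately have "frac (real k * q) \<in> ?T"
    using hi' by (metis (mono_tags, lifting) greaterThanLessThan_iff mem_Collect_eq order_less_le_trans)
  then have "hi' \<le> frac (real k * q)" unfolding hi'_def using fin by (intro Min_le) auto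
  with \<open>frac (real k * q) < hi'\<close> show False by simp
qed

text \<open>In a finite set an orbit of \<open>h\<close> closes up. The steps around the cycle add
  up to a positive multiple of \<open>q\<close> that vanishes on the circle, against
  irrationality.\<close>

lemma no_finite_forward_orbit:
  assumes "q \<notin> \<rat>" "finite N" "x \<in> N" "\<And>y. y \<in> N \<Longrightarrow> h y \<in> N"
    "\<And>y. y \<in> N \<Longrightarrow> \<exists>j::nat>0. h y = y + circle_of (real j * q)"
  shows False
proof -
  have N: "(h ^^ n) x \<in> N" for n
    using assms(3,4) by (induction n) auto
  have step: "\<exists>j\<ge>n. (h ^^ n) y = y + circle_of (real j * q)" if "\<And>i. (h ^^ i) y \<in> N" for n y
  proof (induction n)
    case 0
    then show ?case by (intro exI[of _ 0]) (simp add: circle_of_0)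
  next
    case (Suc n)
    then obtain j where j: "j \<ge> n" "(h ^^ n) y = y + circle_of (real j * q)" by blast
    obtain i where i: "i > 0" "h ((h ^^ n) y) = (h ^^ n) y + circle_of (real i * q)"
      using assms(5) \<open>\<And>i. (h ^^ i) y \<in> N\<close> by blast
    show ?case
      using i j by (intro exI[of _ "j + i"]) (simp add: add.assoc ring_distribs flip: circle_of_add)
  qed
  have "\<not> inj (\<lambda>n. (h ^^ n) x)"
    using N finite_subset[OF _ assms(2)] by (metis image_subsetI range_inj_infinite)
  then obtain m n where mn: "m < n" "(h ^^ m) x = (h ^^ n) x"
    unfolding inj_def by (metis linorder_neqE_nat)
  define y where "y = (h ^^ m) x"
  have y: "(h ^^ i) y \<in> N" for i
    using N[of "i + m"] by (simp add: y_def funpow_add)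
  have "(h ^^ (n - m)) y = (h ^^ (n - m + m)) x"
    by (simp only: y_def funpow_add comp_apply)
  then have "(h ^^ (n - m)) y = y"
    using mn by (simp add: y_def)
  with step[OF y, of "n - m"] obtain j where "j \<ge> n - m" "circle_of (real j * q) = 0"
    by auto
  then have "circle_of (of_int (int j) * q) = circle_of (of_int 0 * q)"
    by (simp add: circle_of_0)
  then show False using multiple_eq_iff[OF assms(1)] \<open>j \<ge> n - m\<close> mn by (metis of_nat_eq_0_iff diff_is_0_eq leD le_zero_eq)
qed

text \<open>\<open>L\<close> stands for the lifted group after conjugation;
  \<open>nearly_eq_imp_eq\<close> expresses that the projection to \<open>PC\<close> is injective on
  it. Hence any relation that holds up to finitely many points holds exactly in
  \<open>L\<close>.\<close>

locale rotation_lift =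
  fixes L :: "(circle \<Rightarrow> circle) set" and q :: real
  assumes irrational: "q \<notin> \<rat>" and q_bounds: "1 / 4 < q" "q < 1 / 3"
    and bij: "f \<in> L \<Longrightarrow> bij f"
    and comp_closed: "f \<in> L \<Longrightarrow> g \<in> L \<Longrightarrow> f \<circ> g \<in> L"
    and inv_closed: "f \<in> L \<Longrightarrow> inv_into UNIV f \<in> L"
    and nearly_eq_imp_eq: "f \<in> L \<Longrightarrow> g \<in> L \<Longrightarrow> nearly_eq f g \<Longrightarrow> f = g"
    and rot_mem: "rot q \<in> L"
begin

text \<open>Two permutations commute at every point outside their common support and its two
  preimages, so here they commute up to finitely many points.\<close>

lemma commute_if_finite_meet:
  assumes "f \<in> L" "g \<in> L" "finite ({x. f x \<noteq> x} \<inter> {x. g x \<noteq> x})" (is "finite ?I")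
  shows "f (g x) = g (f x)"
proof -
  have inj: "inj f" "inj g" using assms bij bij_is_inj by blast+
  then have "finite (?I \<union> f -` ?I \<union> g -` ?I)"
    using assms by (intro finite_UnI finite_vimageI)
  moreover have "{x. (f \<circ> g) x \<noteq> (g \<circ> f) x} \<subseteq> ?I \<union> f -` ?I \<union> g -` ?I"
  proof (rule subsetI, rule ccontr)
    fix x assume x: "x \<in> {x. (f \<circ> g) x \<noteq> (g \<circ> f) x}" "x \<notin> ?I \<union> f -` ?I \<union> g -` ?I"
    then have "f x = x \<or> g x = x" "f x = x \<or> g (f x) = f x" "g x = x \<or> f (g x) = g x"
      using inj by (auto simp: inj_eq)
    then have "f (g x) = g (f x)" by metis
    with x(1) show False by simp
  qed
  ultimately have "nearly_eq (f \<circ> g) (g \<circ> f)"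
    unfolding nearly_eq_def by (rule rev_finite_subset)
  then have "f \<circ> g = g \<circ> f"
    using assms comp_closed nearly_eq_imp_eq by blast
  then show ?thesis by (metis comp_apply)
qed

section \<open>Genuine rotations and the genuine flip in the lift\<close>

lemma inv_rot: "inv_into UNIV (rot t) = rot (- t)"
  by (rule inv_unique_comp) (simp_all add: rot_comp, simp_all add: rot_def fun_eq_iff circle_of_0)

lemma rot_multiple_mem: "rot (of_int k * q) \<in> L"
proof -
  have nat: "rot (real n * q) \<in> L" for n
  proof (induction n)
    case 0
    have "rot q \<circ> rot (- q) \<in> L" using rot_mem inv_closed comp_closed by (metis inv_rot)
    then show ?case by (simp add: rot_comp)
  next
    case (Suc n)
    then have "rot q \<circ> rot (real n * q) \<in> L" using rot_mem comp_closed by blast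
    then show ?case by (simp add: rot_comp algebra_simps)
  qed
  show ?thesis
  proof (cases k)
    case (nonneg n)
    then show ?thesis using nat[of n] by simp
  next
    case (neg n)
    then have "of_int k * q = - (real (Suc n) * q)"
      by (simp only: of_int_minus of_int_of_nat_eq mult_minus_left)
    then show ?thesis using inv_closed[OF nat[of "Suc n"]] by (simp only: inv_rot)
  qed
qed

lemma rot_combination_mem: "rot (of_int k * q + of_int m) \<in> L"
proof -
  have "rot (of_int k * q + of_int m) = rot (of_int k * q)"
    by (simp add: rot_def circle_of_add circle_of_int fun_eq_iff)
  then show ?thesis using rot_multiple_mem by simp
qed

text \<open>The flip inverts \<open>rot q\<close>, exactly so in \<open>L\<close>. This ties the
  value at \<open>x\<close> to values far along the orbit of \<open>x\<close>, where
  \<open>\<sigma>\<close> already agrees with negation.\<close>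

lemma flip_eq:
  assumes "\<sigma> \<in> L" "nearly_eq \<sigma> uminus"
  shows "\<sigma> = uminus"
proof -
  have "nearly_eq (\<sigma> \<circ> rot q) (uminus \<circ> rot q)"
    by (intro nearly_eq_comp assms bij_is_inj bij_rot) simp
  moreover have "uminus \<circ> rot q = rot (- q) \<circ> uminus"
    by (simp add: rot_def circle_of_minus fun_eq_iff)
  moreover have "nearly_eq (rot (- q) \<circ> uminus) (rot (- q) \<circ> \<sigma>)"
    by (intro nearly_eq_comp nearly_eq_sym[OF assms(2)] bij_is_inj bij_uminus_circle) simp
  ultimately have "nearly_eq (\<sigma> \<circ> rot q) (rot (- q) \<circ> \<sigma>)"
    by (metis nearly_eq_trans)
  moreover have "rot (- q) \<in> L" using inv_closed[OF rot_mem] by (simp add: inv_rot)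
  ultimately have eq: "\<sigma> \<circ> rot q = rot (- q) \<circ> \<sigma>"
    using assms(1) rot_mem comp_closed nearly_eq_imp_eq by blast
  have shift: "\<sigma> (x + circle_of (real n * q)) = \<sigma> x - circle_of (real n * q)" for n x
  proof (induction n)
    case (Suc n)
    have "\<sigma> (x + circle_of (real (Suc n) * q)) = (\<sigma> \<circ> rot q) (x + circle_of (real n * q))"
      by (simp add: rot_def algebra_simps circle_of_add)
    also have "\<dots> = \<sigma> x - circle_of (real n * q) - circle_of q"
      unfolding eq using Suc by (simp add: rot_def circle_of_minus)
    finally show ?case by (simp add: algebra_simps circle_of_add)
  qed (simp add: circle_of_0)
  show ?thesis
  proof
    fix x
    obtain n where "x + circle_of (real n * q) \<notin> {x. \<sigma> x \<noteq> - x}"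
      using multiple_eventually_avoids[OF irrational] assms(2) unfolding nearly_eq_def by blast
    with shift[of x n] show "\<sigma> x = - x" by (simp add: algebra_simps)
  qed
qed

abbreviation arc :: "circle set" where
  "arc \<equiv> circle_of ` {0..1 - 2 * q}"

text \<open>The set \<open>M\<close> of exterior points moved by \<open>g\<close> is finite. If a rotated copy \<open>h\<close> of \<open>g\<close> lives on an
  arc disjoint from the one of \<open>g\<close>, then it commutes with \<open>g\<close>, so it preserves the part of \<open>M\<close> in its
  arc. For a generic rotation it acts there by positive multiples of \<open>q\<close>, hence without finite
  orbits.\<close>

lemma lift_exchange_fixes_exterior:
  assumes g: "g \<in> L" "nearly_eq g (exchange q)" and x: "x \<notin> arc"
  shows "g x = x"
proof (rule ccontr)
  assume gx: "g x \<noteq> x"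
  define l where "l = 1 - 2 * q"
  have l: "0 < l" "l < 1 / 2" using q_bounds by (auto simp: l_def)
  define F where "F = {x. g x \<noteq> exchange q x}"
  define M where "M = {x. g x \<noteq> x \<and> x \<notin> arc}"
  have F: "finite F" using g(2) by (simp add: F_def nearly_eq_def)
  have "M \<subseteq> F" using exchange_exterior[OF q_bounds] by (auto simp: M_def F_def)
  then have M: "finite M" using F by (rule finite_subset)
  obtain s where s: "0 \<le> s" "s < 1" "x = circle_of s" by (rule circle_unit_rep)
  have "l < s" using x s by (auto simp: l_def)
  \<comment> \<open>The bounds \<open>l\<close> and \<open>1 - l\<close> make the rotated arc
    disjoint from \<open>arc\<close>; \<open>s - l < t < s\<close> puts \<open>x\<close> inside the
    rotated one.\<close>
  define T where "T = {t \<in> {max l (s - l)<..<min s (1 - l)}. \<exists>k m :: int. t = of_int k * q + of_int m}"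
  have "infinite T"
    unfolding T_def using irrational l s \<open>l < s\<close> by (intro infinite_dense_rotations) auto
  moreover have "inj_on circle_of T"
    by (rule inj_on_subset[OF inj_on_circle_of[of 1 0]]) (use l s in \<open>auto simp: T_def\<close>)
  ultimately have "infinite (circle_of ` T)" by (simp add: finite_image_iff)
  \<comment> \<open>These are the rotations that would carry an exceptional point of
    \<open>g\<close> onto a point of \<open>M\<close>; for any other \<open>t\<close>, the copy
    \<open>h\<close> is a true rotated exchange on all of \<open>M\<close>.\<close>
  moreover have "finite ((\<lambda>(m, f). m - f) ` (M \<times> F))" using M F by simp
  ultimately have "\<not> circle_of ` T \<subseteq> (\<lambda>(m, f). m - f) ` (M \<times> F)"
    by (blast dest: finite_subset)
  then obtain t where t: "t \<in> T" "circle_of t \<notin> (\<lambda>(m, f). m - f) ` (M \<times> F)"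
    by blast
  then obtain k m :: int where km: "t = of_int k * q + of_int m" by (auto simp: T_def)
  have t_bounds: "l < t" "s - l < t" "t < s" "t < 1 - l" using t(1) by (auto simp: T_def)
  have generic: "y - circle_of t \<notin> F" if "y \<in> M" for y
  proof
    assume "y - circle_of t \<in> F"
    with that have "(\<lambda>(m, f). m - f) (y, y - circle_of t) \<in> (\<lambda>(m, f). m - f) ` (M \<times> F)"
      by (intro imageI SigmaI)
    with t(2) show False by simp
  qed
  have disjoint: "y - circle_of t \<notin> arc" if "y \<in> arc" for y
  proof
    assume "y - circle_of t \<in> arc"
    with that obtain u v where uv: "u \<in> {0..l}" "v \<in> {0..l}" "y = circle_of u" "y - circle_of t = circle_of v"
      unfolding l_def by (elim imageE) blast
    then have "circle_of u = circle_of (v + t)" by (simp add: circle_of_add flip: uv(4))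
    then have "u = v + t" by (rule circle_of_inj) (use uv t_bounds l in auto)
    with uv t_bounds show False by simp
  qed
  define h where "h = rot t \<circ> g \<circ> rot (- t)"
  have h: "h y = g (y - circle_of t) + circle_of t" for y
    by (simp add: h_def rot_def circle_of_minus)
  have "h \<in> L"
    using rot_combination_mem[of k m] rot_combination_mem[of "- k" "- m"] g(1)
    unfolding h_def km by (intro comp_closed) auto
  have "finite (F \<union> (\<lambda>y. y + circle_of t) ` F)" using F by simp
  moreover have "{x. g x \<noteq> x} \<inter> {x. h x \<noteq> x} \<subseteq> F \<union> (\<lambda>y. y + circle_of t) ` F"
  proof
    fix y assume y: "y \<in> {x. g x \<noteq> x} \<inter> {x. h x \<noteq> x}"
    then have "y \<in> arc \<or> y \<in> F" using exchange_exterior[OF q_bounds, of y] by (auto simp: F_def)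
    moreover have "g (y - circle_of t) \<noteq> y - circle_of t"
      using y unfolding h by auto
    then have "y - circle_of t \<in> arc \<or> y - circle_of t \<in> F"
      using exchange_exterior[OF q_bounds, of "y - circle_of t"] by (auto simp: F_def)
    moreover have "y = y - circle_of t + circle_of t" by simp
    ultimately show "y \<in> F \<union> (\<lambda>y. y + circle_of t) ` F"
      using disjoint by blast
  qed
  ultimately have "finite ({x. g x \<noteq> x} \<inter> {x. h x \<noteq> x})"
    by (rule rev_finite_subset)
  then have comm: "g (h y) = h (g y)" for y
    by (rule commute_if_finite_meet[OF g(1) \<open>h \<in> L\<close>])
  \<comment> \<open>The half-open interval excludes the right endpoint, which
    \<open>exchange q\<close> does not move.\<close>
  define N where "N = {y \<in> M. y - circle_of t \<in> circle_of ` {0..<1 - 2 * q}}"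
  have hN: "h y = exchange q (y - circle_of t) + circle_of t" if "y \<in> N" for y
    using that generic[of y] unfolding h N_def F_def by simp
  show False
  proof (rule no_finite_forward_orbit[OF irrational])
    show "finite N" using M by (simp add: N_def)
    show "x \<in> N"
    proof -
      have "x - circle_of t = circle_of (s - t)" using s by (simp add: circle_of_diff)
      with t_bounds have "x - circle_of t \<in> circle_of ` {0..<1 - 2 * q}"
        by (auto simp: l_def)
      with gx x show ?thesis by (simp add: N_def M_def)
    qed
    fix y assume y: "y \<in> N"
    have *: "h y - circle_of t \<in> circle_of ` {0..<1 - 2 * q}"
      using hN[OF y] exchange_interior(1)[OF q_bounds] y by (simp add: N_def)
    moreover have "circle_of ` {0..<1 - 2 * q} \<subseteq> arc" by (intro image_mono) auto
    ultimately have "h y \<notin> arc" using disjoint by blast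
    moreover have "g (h y) \<noteq> h y"
      unfolding comm using bij[OF \<open>h \<in> L\<close>] y by (auto simp: N_def M_def bij_is_inj inj_eq)
    ultimately show "h y \<in> N" using * by (simp add: N_def M_def)
    obtain j :: nat where "j > 0" "exchange q (y - circle_of t) = y - circle_of t + circle_of (real j * q)"
      using exchange_interior(2)[OF q_bounds] y by (auto simp: N_def)
    then show "\<exists>j::nat>0. h y = y + circle_of (real j * q)"
      unfolding hN[OF y] by (intro exI[of _ j]) (simp add: algebra_simps)
  qed
qed

text \<open>Reflecting the arc in an endpoint \<open>e\<close> gives an arc that meets it only in \<open>e\<close>, so \<open>g\<close>
  commutes with its mirror image. If \<open>g\<close> moved \<open>e\<close>, then so would the mirror image, and the two
  would fail to commute at \<open>e\<close>.\<close>

lemma lift_exchange_fixes_endpoint: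
  assumes g: "g \<in> L" "nearly_eq g (exchange q)"
    and \<tau>: "\<tau> \<in> L" "\<And>x. \<tau> (\<tau> x) = x" "\<tau> e = e" and meet: "arc \<inter> \<tau> ` arc = {e}"
  shows "g e = e"
proof (rule ccontr)
  define u where "u = g e"
  assume "g e \<noteq> e"
  then have u: "u \<noteq> e" by (simp add: u_def)
  have ext: "g x = x" if "x \<notin> arc" for x
    using that g by (rule lift_exchange_fixes_exterior[rotated 2])
  define h where "h = \<tau> \<circ> g \<circ> \<tau>"
  have "h \<in> L" using g \<tau> by (auto simp: h_def intro: comp_closed)
  have "{x. g x \<noteq> x} \<inter> {x. h x \<noteq> x} \<subseteq> {e}"
  proof
    fix x assume x: "x \<in> {x. g x \<noteq> x} \<inter> {x. h x \<noteq> x}"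
    then have "\<tau> (g (\<tau> x)) \<noteq> \<tau> (\<tau> x)" using \<tau>(2) by (simp add: h_def)
    then have "\<tau> x \<in> arc" using ext by metis
    moreover have "x = \<tau> (\<tau> x)" using \<tau>(2) by simp
    ultimately have "x \<in> \<tau> ` arc" by blast
    moreover have "x \<in> arc" using x ext by auto
    ultimately show "x \<in> {e}" using meet by blast
  qed
  then have "finite ({x. g x \<noteq> x} \<inter> {x. h x \<noteq> x})"
    by (rule finite_subset) simp
  then have comm: "g (h e) = h (g e)"
    by (rule commute_if_finite_meet[OF g(1) \<open>h \<in> L\<close>])
  \<comment> \<open>Exterior points are fixed, so by injectivity none of them can be the image of
    \<open>e\<close>.\<close>
  have "u \<in> arc"
  proof (rule ccontr)
    assume "u \<notin> arc"
    then have "g u = g e" using ext u_def by simp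
    then show False using u bij[OF g(1)] by (simp add: bij_is_inj inj_eq)
  qed
  have "\<tau> u \<notin> arc"
  proof
    assume "\<tau> u \<in> arc"
    with \<open>u \<in> arc\<close> meet have "\<tau> u = e" by blast
    with \<tau> u show False by metis
  qed
  then have "g (\<tau> u) = \<tau> u" by (rule ext)
  \<comment> \<open>\<open>h\<close> sends \<open>e\<close> to \<open>\<tau> u\<close>, which
    \<open>g\<close> fixes, and \<open>h\<close> fixes \<open>u\<close> because \<open>g\<close>
    fixes \<open>\<tau> u\<close>. Commutation would give \<open>\<tau> u = u\<close>, although only
    \<open>u\<close> lies in the arc.\<close>
  then have "g (h e) = \<tau> u" "h (g e) = u"
    using \<tau>(2)[of u] \<tau>(3) by (simp_all add: h_def flip: u_def)
  with comm \<open>u \<in> arc\<close> \<open>\<tau> u \<notin> arc\<close> show False by simp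
qed

lemma no_lift_exchange:
  assumes g: "g \<in> L" "nearly_eq g (exchange q)"
    and \<sigma>: "\<sigma> \<in> L" "nearly_eq \<sigma> uminus"
  shows False
proof -
  have um: "uminus \<in> L" using \<sigma>(1) unfolding flip_eq[OF \<sigma>] .
  have g0: "g 0 = 0"
  proof (rule lift_exchange_fixes_endpoint[OF g um])
    have "x = 0" if "x \<in> arc" "- x \<in> arc" for x
    proof -
      obtain s t where st: "s \<in> {0..1 - 2 * q}" "t \<in> {0..1 - 2 * q}" "x = circle_of s" "- x = circle_of t"
        using \<open>x \<in> arc\<close> \<open>- x \<in> arc\<close> by auto
      then have "circle_of (s + t) = circle_of 0" by (simp add: circle_of_add circle_of_0 flip: st(4))
      then have "s + t = 0" by (rule circle_of_inj) (use st q_bounds in auto)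
      with st(1,2) have "s = 0" by simp
      with st(3) show ?thesis by (simp add: circle_of_0)
    qed
    moreover have "0 \<in> arc"
      using imageI[of 0 "{0..1 - 2 * q}" circle_of] q_bounds by (simp add: circle_of_0)
    moreover from this have "0 \<in> uminus ` arc" by (metis imageI minus_zero)
    moreover have "- x \<in> arc" if "x \<in> uminus ` arc" for x using that by force
    ultimately show "arc \<inter> uminus ` arc = {0}" by blast
    show "- 0 = (0 :: circle)" "- (- x) = x" for x :: circle by simp_all
  qed
  let ?e = "circle_of (- 2 * q)"
  have e: "?e = circle_of (1 - 2 * q)" by (simp add: circle_of_eq_iff)
  have ge: "g ?e = ?e"
  proof (rule lift_exchange_fixes_endpoint[OF g])
    \<comment> \<open>The reflection of the circle that takes \<open>x\<close> to
      \<open>-4q - x\<close> fixes \<open>-2q\<close>, which is the right endpoint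
      \<open>1 - 2q\<close>.\<close>
    let ?\<tau> = "rot (of_int (- 4) * q) \<circ> uminus"
    show "?\<tau> \<in> L" by (intro comp_closed rot_multiple_mem um)
    show "?\<tau> (?\<tau> x) = x" for x by (simp add: rot_def)
    have \<tau>: "?\<tau> (circle_of u) = circle_of (of_int (- 4) * q - u)" for u
      by (simp only: comp_apply rot_def circle_of_diff uminus_add_conv_diff)
    show \<tau>e: "?\<tau> ?e = ?e" unfolding \<tau> by (rule arg_cong[of _ _ circle_of]) simp
    have "x = ?e" if x: "x \<in> arc" "x \<in> ?\<tau> ` arc" for x
    proof -
      obtain s t where st: "s \<in> {0..1 - 2 * q}" "t \<in> {0..1 - 2 * q}" "x = circle_of s" "x = ?\<tau> (circle_of t)"
        using x by (elim imageE) blast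
      have "circle_of s = circle_of (of_int (- 4) * q - t)"
        using st(3,4) \<tau> by metis
      \<comment> \<open>Adding 2 moves the representative into [1 - 2q, 2 - 4q], less than one turn
        from \<open>s\<close>; the two ranges share only \<open>1 - 2q\<close>.\<close>
      also have "\<dots> = circle_of (2 - t - 4 * q)" by (simp add: circle_of_eq_iff)
      finally have "s = 2 - t - 4 * q" by (rule circle_of_inj) (use st q_bounds in auto)
      then have "s = 1 - 2 * q" using st(1,2) by auto
      then show ?thesis by (simp only: st(3) e)
    qed
    moreover have "?e \<in> arc" unfolding e using q_bounds by (intro imageI) auto
    moreover have "?e \<in> ?\<tau> ` arc" by (subst \<tau>e[symmetric]) (rule imageI, fact)
    ultimately show "arc \<inter> ?\<tau> ` arc = {?e}" by blast
  qed
  have gm: "g (circle_of (- q)) = circle_of (- q)"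
  proof (rule lift_exchange_fixes_exterior[OF g])
    have "circle_of (- q) = circle_of (1 - q)" by (simp add: circle_of_eq_iff)
    also have "\<dots> \<notin> arc" using q_bounds by (subst circle_of_mem_image_iff) auto
    finally show "circle_of (- q) \<notin> arc" .
  qed
  let ?r = "rot (- q)"
  have r: "?r \<in> L" using rot_multiple_mem[of "- 1"] by simp
  have inj: "inj f" if "f \<in> L" for f using bij[OF that] by (rule bij_is_inj)
  have relation: "exchange q \<circ> ?r \<circ> exchange q \<circ> ?r \<circ> exchange q = rot q"
    using exchange_rot_relation[OF q_bounds] by (simp add: fun_eq_iff)
  have "nearly_eq (g \<circ> ?r \<circ> g \<circ> ?r \<circ> g) (exchange q \<circ> ?r \<circ> exchange q \<circ> ?r \<circ> exchange q)"
    by (intro nearly_eq_comp[OF _ _ inj] nearly_eq_refl g r)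
  then have "g \<circ> ?r \<circ> g \<circ> ?r \<circ> g = rot q"
    unfolding relation using g(1) r rot_mem by (intro nearly_eq_imp_eq comp_closed)
  \<comment> \<open>The left side carries 0 through \<open>-q\<close> to \<open>-2q\<close>, with
    \<open>g\<close> fixing each stop, whereas the right side is \<open>q\<close>.\<close>
  then have "g (?r (g (?r (g 0)))) = rot q 0" by (simp only: fun_eq_iff comp_apply)
  moreover have "?r (g 0) = circle_of (- q)" unfolding g0 by (simp add: rot_def)
  moreover have "?r (circle_of (- q)) = circle_of (- q + - q)"
    by (simp only: rot_def circle_of_add)
  moreover have "- q + - q = - 2 * q" by simp
  moreover have "rot q 0 = circle_of q" by (simp add: rot_def)
  ultimately have "?e = circle_of q" by (simp only: gm ge)
  then have "circle_of (of_int (- 2) * q) = circle_of (of_int 1 * q)" by simp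
  then show False by (simp only: multiple_eq_iff[OF irrational])
qed

end

text \<open>The conjugating map \<open>\<psi>\<close> is nearly the identity, so conjugates still
  lift the same elements of \<open>PC\<close>; only the lift of \<open>rot q\<close> has been
  straightened.\<close>

lemma no_lift:
  fixes L :: "(circle \<Rightarrow> circle) set"
  assumes bounds: "1 / 4 < q" "q < 1 / 3"
    and indep: "\<And>m k :: int. of_int m * q + of_int k * b \<in> \<int> \<Longrightarrow> m = 0 \<and> k = 0"
    and irr: "q \<notin> \<rat>"
    and bij: "\<And>f. f \<in> L \<Longrightarrow> bij f"
    and comp: "\<And>f g. f \<in> L \<Longrightarrow> g \<in> L \<Longrightarrow> f \<circ> g \<in> L"
    and inv: "\<And>f. f \<in> L \<Longrightarrow> inv_into UNIV f \<in> L"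
    and near: "\<And>f g. f \<in> L \<Longrightarrow> g \<in> L \<Longrightarrow> nearly_eq f g \<Longrightarrow> f = g"
    and A: "A \<in> L" "nearly_eq A (rot q)" and B: "B \<in> L" "nearly_eq B (rot b)"
    and \<sigma>: "\<sigma> \<in> L" "nearly_eq \<sigma> uminus" and g: "g \<in> L" "nearly_eq g (exchange q)"
  shows False
proof -
  have "nearly_eq (A \<circ> B) (rot q \<circ> rot b)" "nearly_eq (B \<circ> A) (rot b \<circ> rot q)"
    using A B bij by (auto intro: nearly_eq_comp bij_is_inj)
  then have "nearly_eq (A \<circ> B) (B \<circ> A)"
    unfolding rot_comp by (metis add.commute nearly_eq_sym nearly_eq_trans)
  then have "A \<circ> B = B \<circ> A" using A B comp near by blast
  then obtain \<psi> where \<psi>: "bij \<psi>" "nearly_eq \<psi> id" "A \<circ> \<psi> = \<psi> \<circ> rot q"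
    using commuting_rotations_rigid[of A B q b] A B bij indep by metis
  define \<phi> where "\<phi> = inv_into UNIV \<psi>"
  have \<phi>: "bij \<phi>" "\<phi> (\<psi> x) = x" "\<psi> (\<phi> x) = x" for x
    using \<psi>(1) by (simp_all add: \<phi>_def bij_imp_bij_inv bij_is_inj bij_is_surj surj_f_inv_f)
  have "{x. \<phi> x \<noteq> x} \<subseteq> {x. \<psi> x \<noteq> x}" 
  proof (rule Collect_mono, rule impI, rule notI)
    fix x assume "\<phi> x \<noteq> x" "\<psi> x = x"
    then show False using \<phi>(2)[of x] by simp
  qed
  then have \<phi>_near: "nearly_eq \<phi> id"
    using \<psi>(2) by (auto simp: nearly_eq_def intro: finite_subset)
  define conj where "conj f = \<phi> \<circ> f \<circ> \<psi>" for f
  have conj_comp: "conj (f \<circ> g) = conj f \<circ> conj g" for f g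
    by (simp add: conj_def fun_eq_iff \<phi>)
  have conj_near: "nearly_eq (conj f) f'" if "f \<in> L" "nearly_eq f f'" for f f'
  proof -
    have "nearly_eq (\<phi> \<circ> f \<circ> \<psi>) (id \<circ> f' \<circ> id)"
      using that \<psi> \<phi>_near bij by (intro nearly_eq_comp) (auto simp: bij_is_inj)
    then show ?thesis by (simp add: conj_def)
  qed
  interpret rotation_lift "conj ` L" q
  proof
    show "q \<notin> \<rat>" "1 / 4 < q" "q < 1 / 3" by fact+
    show "bij f" if "f \<in> conj ` L" for f
      using that bij \<psi>(1) \<phi>(1) by (auto simp: conj_def intro!: bij_comp)
    show "f \<circ> h \<in> conj ` L" if "f \<in> conj ` L" "h \<in> conj ` L" for f h
      using that comp by (auto simp flip: conj_comp)
    show "inv_into UNIV f \<in> conj ` L" if f: "f \<in> conj ` L" for f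
    proof -
      obtain h where h: "h \<in> L" "f = conj h" using f by blast
      have "inv_into UNIV f = conj (inv_into UNIV h)"
      proof (rule inv_unique_comp)
        have "h \<circ> inv_into UNIV h = id" "inv_into UNIV h \<circ> h = id"
          using bij_is_surj[OF bij[OF h(1)]] bij_is_inj[OF bij[OF h(1)]] by (simp_all add: surj_iff)
        moreover have "conj id = id" by (simp add: conj_def fun_eq_iff \<phi>)
        ultimately show "f \<circ> conj (inv_into UNIV h) = id" "conj (inv_into UNIV h) \<circ> f = id"
          by (simp_all add: h(2) flip: conj_comp)
      qed
      then show ?thesis using inv[OF h(1)] by simp
    qed
    show "f = h" if fh: "f \<in> conj ` L" "h \<in> conj ` L" "nearly_eq f h" for f h
    proof -
      obtain f' h' where f'h': "f' \<in> L" "h' \<in> L" "f = conj f'" "h = conj h'" using fh by blast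
      have "nearly_eq f f'" "nearly_eq h h'"
        using f'h' conj_near nearly_eq_refl by blast+
      with fh(3) have "nearly_eq f' h'" by (metis nearly_eq_sym nearly_eq_trans)
      with f'h' near show "f = h" by blast
    qed
    have "conj A = rot q"
      unfolding conj_def comp_assoc \<psi>(3) by (simp add: fun_eq_iff \<phi>)
    with A(1) show "rot q \<in> conj ` L" by (metis imageI)
  qed
  show False
    using no_lift_exchange[OF imageI[OF g(1)] conj_near[OF g] imageI[OF \<sigma>(1)] conj_near[OF \<sigma>]] .
qed

text \<open>For irrational \<open>q\<close> only countably many \<open>b\<close> satisfy a rational
  relation with 1 and \<open>q\<close>.\<close>

lemma exists_independent_pair:
  obtains q b :: real where "1 / 4 < q" "q < 1 / 3" "q \<notin> \<rat>"
    "\<And>m k :: int. of_int m * q + of_int k * b \<in> \<int> \<Longrightarrow> m = 0 \<and> k = 0"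
proof -
  have "uncountable {1 / 4<..<1 / 3 :: real}" by (simp add: uncountable_open_interval)
  then have "\<not> {1 / 4<..<1 / 3 :: real} \<subseteq> \<rat>"
    using countable_rat countable_subset by blast
  then obtain q :: real where "q \<in> {1 / 4<..<1 / 3}" "q \<notin> \<rat>" by blast
  then have q: "1 / 4 < q" "q < 1 / 3" "q \<notin> \<rat>" by simp_all
  have "countable (range (\<lambda>(m, k, n). (of_int n - of_int m * q) / of_int k) :: real set)"
    by (rule countable_image) simp
  then obtain b where b: "b \<notin> range (\<lambda>(m :: int, k :: int, n :: int). (of_int n - of_int m * q) / of_int k)"
    using uncountable_UNIV_real by (metis UNIV_eq_I)
  show ?thesis
  proof (rule that[OF q])
    fix m k :: int assume "of_int m * q + of_int k * b \<in> \<int>"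
    then obtain n where n: "of_int m * q + of_int k * b = of_int n" by (auto elim: Ints_cases)
    have k: "k = 0"
    proof (rule ccontr)
      assume "k \<noteq> 0"
      with n have "b = (of_int n - of_int m * q) / of_int k" by (simp add: field_simps)
      with b show False by (auto simp: image_iff)
    qed
    have "m = 0"
    proof (rule ccontr)
      assume "m \<noteq> 0"
      with n k have "q = of_int n / of_int m" by (simp add: field_simps)
      with q(3) show False by (metis Rats_divide Rats_of_int)
    qed
    with k show "m = 0 \<and> k = 0" by simp
  qed
qed

subsection \<open>The groups of piecewise continuous permutations\<close>

lemma Bij_UNIV: "f \<in> Bij UNIV \<longleftrightarrow> bij f"
  by (simp add: Bij_def extensional_def)

lemma carrier_PC_hat:
  "f \<in> carrier PC_hat \<longleftrightarrow> bij f \<and> (\<exists>F. finite F \<and> continuous_on (- F) f)"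
  by (auto simp: PC_hat_def BijGroup_def Bij_UNIV)

lemma mult_PC_hat: "bij f \<Longrightarrow> bij g \<Longrightarrow> f \<otimes>\<^bsub>PC_hat\<^esub> g = f \<circ> g"
  by (simp add: PC_hat_def BijGroup_def Bij_UNIV compose_def fun_eq_iff)

lemma one_PC_hat: "\<one>\<^bsub>PC_hat\<^esub> = id"
  by (simp add: PC_hat_def BijGroup_def fun_eq_iff)

lemma group_PC_hat: "group PC_hat"
proof (rule groupI)
  fix f g assume fg: "f \<in> carrier PC_hat" "g \<in> carrier PC_hat"
  then obtain F G where FG: "finite F" "continuous_on (- F) f" "finite G" "continuous_on (- G) g"
    by (auto simp: carrier_PC_hat)
  have bij: "bij f" "bij g" using fg by (auto simp: carrier_PC_hat)
  have "continuous_on (- (G \<union> g -` F)) (f \<circ> g)"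
    using FG by (intro continuous_on_compose) (auto intro: continuous_on_subset)
  moreover have "finite (G \<union> g -` F)"
    using FG bij by (simp add: finite_vimageI bij_is_inj)
  ultimately show "f \<otimes>\<^bsub>PC_hat\<^esub> g \<in> carrier PC_hat"
    using bij by (auto simp: mult_PC_hat carrier_PC_hat intro: bij_comp)
next
  show "\<one>\<^bsub>PC_hat\<^esub> \<in> carrier PC_hat"
    by (auto simp: one_PC_hat carrier_PC_hat intro: continuous_on_id)
next
  fix f g h assume "f \<in> carrier PC_hat" "g \<in> carrier PC_hat" "h \<in> carrier PC_hat"
  then show "f \<otimes>\<^bsub>PC_hat\<^esub> g \<otimes>\<^bsub>PC_hat\<^esub> h = f \<otimes>\<^bsub>PC_hat\<^esub> (g \<otimes>\<^bsub>PC_hat\<^esub> h)"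
    by (simp add: carrier_PC_hat mult_PC_hat bij_comp comp_assoc)
next
  fix f assume "f \<in> carrier PC_hat"
  then show "\<one>\<^bsub>PC_hat\<^esub> \<otimes>\<^bsub>PC_hat\<^esub> f = f"
    by (simp add: carrier_PC_hat mult_PC_hat one_PC_hat)
next
  fix f assume "f \<in> carrier PC_hat"
  then obtain F where f: "bij f" "finite F" "continuous_on (- F) f" by (auto simp: carrier_PC_hat)
  then have "inv_into UNIV f \<in> carrier PC_hat"
    using continuous_on_inv_cofinite by (auto simp: carrier_PC_hat bij_imp_bij_inv)
  moreover have "inv_into UNIV f \<otimes>\<^bsub>PC_hat\<^esub> f = \<one>\<^bsub>PC_hat\<^esub>"
    using f by (simp add: mult_PC_hat one_PC_hat bij_imp_bij_inv bij_is_inj)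
  ultimately show "\<exists>y\<in>carrier PC_hat. y \<otimes>\<^bsub>PC_hat\<^esub> f = \<one>\<^bsub>PC_hat\<^esub>" by blast
qed

interpretation PC_hat: group PC_hat by (rule group_PC_hat)

lemma inv_PC_hat:
  assumes "f \<in> carrier PC_hat"
  shows "m_inv PC_hat f = inv_into UNIV f"
proof -
  have f: "bij f" "bij (m_inv PC_hat f)"
    using assms PC_hat.inv_closed[OF assms] by (simp_all add: carrier_PC_hat)
  then have "m_inv PC_hat f \<circ> f = id" "f \<circ> m_inv PC_hat f = id"
    using PC_hat.l_inv[OF assms] PC_hat.r_inv[OF assms] by (simp_all add: mult_PC_hat one_PC_hat)
  then show ?thesis by (metis inv_unique_comp)
qed

section \<open>The quotient by finitely supported permutations\<close>

lemma Sym_fin_iff: "f \<in> Sym_fin \<longleftrightarrow> bij f \<and> nearly_eq f id"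
  by (simp add: Sym_fin_def BijGroup_def Bij_UNIV nearly_eq_def)

lemma Sym_fin_normal: "Sym_fin \<lhd> PC_hat"
  unfolding PC_hat.normal_inv_iff
proof (intro conjI ballI)
  have sub: "Sym_fin \<subseteq> carrier PC_hat"
  proof
    fix f assume f: "f \<in> Sym_fin"
    have "continuous_on (- {x. f x \<noteq> x}) f"
      by (rule continuous_on_eq[OF continuous_on_id]) auto
    with f show "f \<in> carrier PC_hat"
      by (auto simp: Sym_fin_iff carrier_PC_hat nearly_eq_def)
  qed
  show "subgroup Sym_fin PC_hat"
  proof (rule PC_hat.subgroupI[OF sub])
    show "Sym_fin \<noteq> {}" using Sym_fin_iff[of id] by auto
  next
    fix f assume f: "f \<in> Sym_fin"
    then have "bij f" by (simp add: Sym_fin_iff)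
    then have "{x. inv_into UNIV f x \<noteq> x} \<subseteq> {x. f x \<noteq> x}"
      by (intro Collect_mono impI notI) (auto dest: inv_f_eq[OF bij_is_inj])
    then have "nearly_eq (inv_into UNIV f) id"
      using f by (auto simp: Sym_fin_iff nearly_eq_def intro: finite_subset)
    with f sub show "m_inv PC_hat f \<in> Sym_fin"
      by (auto simp: inv_PC_hat Sym_fin_iff bij_imp_bij_inv)
  next
    fix f g assume "f \<in> Sym_fin" "g \<in> Sym_fin"
    then show "f \<otimes>\<^bsub>PC_hat\<^esub> g \<in> Sym_fin"
      using nearly_eq_comp[of f id g id] by (simp add: Sym_fin_iff mult_PC_hat bij_comp bij_is_inj)
  qed
  fix f s assume f: "f \<in> carrier PC_hat" and s: "s \<in> Sym_fin"
  let ?i = "inv_into UNIV f"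
  have bij: "bij f" "bij s" "bij ?i"
    using f s by (simp_all add: carrier_PC_hat Sym_fin_iff bij_imp_bij_inv)
  have "nearly_eq (f \<circ> s \<circ> ?i) (f \<circ> id \<circ> ?i)"
    using s bij by (intro nearly_eq_comp) (auto simp: Sym_fin_iff bij_is_inj)
  moreover have "f \<circ> id \<circ> ?i = id" using bij_is_surj[OF bij(1)] by (simp add: surj_iff)
  ultimately have "nearly_eq (f \<circ> s \<circ> ?i) id" by (simp only:)
  then show "f \<otimes>\<^bsub>PC_hat\<^esub> s \<otimes>\<^bsub>PC_hat\<^esub> m_inv PC_hat f \<in> Sym_fin"
    using bij by (simp add: inv_PC_hat[OF f] mult_PC_hat bij_comp Sym_fin_iff)
qed

interpretation Sym_fin: normal Sym_fin PC_hat by (rule Sym_fin_normal)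

interpretation PC: group PC
  unfolding PC_def by (rule Sym_fin.factorgroup_is_group)

interpretation PC_proj: group_hom PC_hat PC PC_proj
proof
  show "PC_proj \<in> hom PC_hat PC"
    using Sym_fin.r_coset_hom_Mod by (simp add: PC_proj_def[abs_def] PC_def)
qed

text \<open>Together with its converse below, this translates between cosets and
  \<open>nearly_eq\<close>.\<close>

lemma PC_proj_eq_imp_nearly_eq:
  assumes "f \<in> carrier PC_hat" "g \<in> carrier PC_hat" "PC_proj f = PC_proj g"
  shows "nearly_eq f g"
proof -
  have "f \<in> Sym_fin #>\<^bsub>PC_hat\<^esub> g"
    using PC_hat.rcos_self[OF assms(1) Sym_fin.subgroup_axioms] assms(3) by (simp add: PC_proj_def)
  then obtain s where s: "s \<in> Sym_fin" "f = s \<otimes>\<^bsub>PC_hat\<^esub> g" by (auto simp: r_coset_def)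
  have "bij g" "bij s" using assms(2) s(1) by (simp_all add: carrier_PC_hat Sym_fin_iff)
  then show ?thesis
    using s nearly_eq_comp[of s id g g] by (simp add: mult_PC_hat Sym_fin_iff bij_is_inj)
qed

lemma nearly_eq_imp_PC_proj_eq:
  assumes "f \<in> carrier PC_hat" "g \<in> carrier PC_hat" "nearly_eq f g"
  shows "PC_proj f = PC_proj g"
proof -
  let ?s = "f \<circ> inv_into UNIV g"
  have bij: "bij f" "bij g" using assms by (simp_all add: carrier_PC_hat)
  have "nearly_eq ?s (g \<circ> inv_into UNIV g)"
    using assms(3) bij by (intro nearly_eq_comp) (auto simp: bij_imp_bij_inv bij_is_inj)
  moreover have "g \<circ> inv_into UNIV g = id" using bij_is_surj[OF bij(2)] by (simp add: surj_iff)
  ultimately have s: "?s \<in> Sym_fin"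
    using bij by (simp add: Sym_fin_iff bij_comp bij_imp_bij_inv)
  have "?s \<otimes>\<^bsub>PC_hat\<^esub> g = f"
    using bij by (simp add: mult_PC_hat bij_comp bij_imp_bij_inv comp_assoc bij_is_inj)
  then have "f \<in> Sym_fin #>\<^bsub>PC_hat\<^esub> g"
    using PC_hat.rcosI[OF s Sym_fin.subset assms(2)] by simp
  then show ?thesis
    unfolding PC_proj_def
    by (metis PC_hat.repr_independence Sym_fin.subgroup_axioms assms(2))
qed

text \<open>A lift of the larger group restricts to the elements lying over the smaller one. All
  three claims thereby reduce to one finitely generated group.\<close>

lemma realizable_subgroup:
  assumes "realizable \<Gamma>'" "subgroup \<Gamma> PC" "\<Gamma> \<subseteq> \<Gamma>'"
  shows "realizable \<Gamma>"
proof -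
  obtain \<Lambda> where \<Lambda>: "subgroup \<Lambda> PC_hat" "bij_betw PC_proj \<Lambda> \<Gamma>'"
    using assms(1) by (auto simp: realizable_def)
  let ?\<Lambda> = "{f \<in> \<Lambda>. PC_proj f \<in> \<Gamma>}"
  have "subgroup ?\<Lambda> PC_hat"
  proof
    show "?\<Lambda> \<subseteq> carrier PC_hat" using subgroup.subset[OF \<Lambda>(1)] by blast
    show "\<one>\<^bsub>PC_hat\<^esub> \<in> ?\<Lambda>"
      using subgroup.one_closed[OF \<Lambda>(1)] subgroup.one_closed[OF assms(2)] by simp
    show "f \<otimes>\<^bsub>PC_hat\<^esub> g \<in> ?\<Lambda>" if "f \<in> ?\<Lambda>" "g \<in> ?\<Lambda>" for f g
      using that subgroup.m_closed[OF \<Lambda>(1)] subgroup.m_closed[OF assms(2)] subgroup.mem_carrier[OF \<Lambda>(1)]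
      by auto
    show "m_inv PC_hat f \<in> ?\<Lambda>" if "f \<in> ?\<Lambda>" for f
      using that subgroup.m_inv_closed[OF \<Lambda>(1)] subgroup.m_inv_closed[OF assms(2)] subgroup.mem_carrier[OF \<Lambda>(1)]
      by auto
  qed
  moreover have "PC_proj ` ?\<Lambda> = \<Gamma>"
    using bij_betw_imp_surj_on[OF \<Lambda>(2)] assms(3) by blast
  then have "bij_betw PC_proj ?\<Lambda> \<Gamma>"
    by (intro bij_betw_subset[OF \<Lambda>(2)]) auto
  ultimately show ?thesis unfolding realizable_def by blast
qed

subsection \<open>Permutations with finitely many displacements\<close>

lemma continuous_on_circle_diff:
  fixes f g :: "'a :: topological_space \<Rightarrow> circle"
  assumes "continuous_on S f" "continuous_on S g"
  shows "continuous_on S (\<lambda>x. f x - g x)"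
  unfolding continuous_on_def tendsto_iff
proof (intro ballI allI impI)
  fix x and e :: real assume x: "x \<in> S" and e: "e > 0"
  have "\<forall>\<^sub>F y in at x within S. dist (f y) (f x) < e / 2"
    "\<forall>\<^sub>F y in at x within S. dist (g y) (g x) < e / 2"
    using assms x e unfolding continuous_on_def tendsto_iff by (meson half_gt_zero)+
  then show "\<forall>\<^sub>F y in at x within S. dist (f y - g y) (f x - g x) < e"
  proof eventually_elim
    case (elim y)
    have "dist (f y - g y) (f x - g y) = dist (f y) (f x)"
      using dist_circle_add[of "f y" "- g y" "f x"] by simp
    moreover have "dist (f x - g y) (f x - g x) = dist (g y) (g x)"
      using dist_circle_add[of "- g y" "f x" "- g x"] by (simp add: dist_circle_uminus)
    ultimately show ?case using elim dist_triangle[of "f y - g y" "f x - g x" "f x - g y"] by simp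
  qed
qed

text \<open>A description without pieces of permutations that project into \<open>IET_pm\<close>,
  with \<open>E\<close> giving the common orientation. In this form closure under composition is a
  short computation.\<close>

definition finite_disp :: "(circle \<Rightarrow> circle) set" where
  "finite_disp = {f \<in> carrier PC_hat. \<exists>E\<in>{id, uminus}. finite (range (\<lambda>x. f x - E x))}"

lemma subgroup_finite_disp: "subgroup finite_disp PC_hat"
proof (rule PC_hat.subgroupI)
  show "finite_disp \<subseteq> carrier PC_hat" by (auto simp: finite_disp_def)
  have "id \<in> finite_disp"
    using PC_hat.one_closed by (auto simp: finite_disp_def one_PC_hat)
  then show "finite_disp \<noteq> {}" by blast
next
  fix f assume f: "f \<in> finite_disp"
  then obtain E where E: "E \<in> {id, uminus}" "finite (range (\<lambda>x. f x - E x))" and carrier: "f \<in> carrier PC_hat"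
    unfolding finite_disp_def by blast
  \<comment> \<open>Both choices of \<open>E\<close> are additive involutions.\<close>
  have "inv_into UNIV f x - E x = - E (f (inv_into UNIV f x) - E (inv_into UNIV f x))" for x
    using E(1) carrier by (auto simp: carrier_PC_hat bij_is_surj surj_f_inv_f)
  then have "range (\<lambda>x. inv_into UNIV f x - E x) \<subseteq> (\<lambda>c. - E c) ` range (\<lambda>x. f x - E x)"
    by auto
  then have "finite (range (\<lambda>x. inv_into UNIV f x - E x))"
    using E(2) by (auto intro: finite_subset)
  then show "m_inv PC_hat f \<in> finite_disp"
    using E(1) PC_hat.inv_closed[OF carrier] by (auto simp: finite_disp_def inv_PC_hat[OF carrier])
next
  fix f g assume fg: "f \<in> finite_disp" "g \<in> finite_disp"
  then obtain E E' where E: "E \<in> {id, uminus}" "finite (range (\<lambda>x. f x - E x))"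
    and E': "E' \<in> {id, uminus}" "finite (range (\<lambda>x. g x - E' x))"
    and carrier: "f \<in> carrier PC_hat" "g \<in> carrier PC_hat"
    unfolding finite_disp_def by blast
  let ?R = "range (\<lambda>x. f x - E x) \<times> range (\<lambda>x. g x - E' x)"
  have "(f \<circ> g) x - (E \<circ> E') x = (\<lambda>(c, d). c + E d) (f (g x) - E (g x), g x - E' x)" for x
    using E(1) by auto
  then have "range (\<lambda>x. (f \<circ> g) x - (E \<circ> E') x) \<subseteq> (\<lambda>(c, d). c + E d) ` ?R"
    by (intro image_subsetI) (simp only:, intro imageI SigmaI rangeI)
  then have "finite (range (\<lambda>x. (f \<circ> g) x - (E \<circ> E') x))"
    by (rule finite_subset) (use E(2) E'(2) in simp)
  moreover have "E \<circ> E' \<in> {id, uminus}" using E(1) E'(1) by (auto simp: fun_eq_iff)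
  moreover have "f \<otimes>\<^bsub>PC_hat\<^esub> g = f \<circ> g"
    using carrier by (simp add: carrier_PC_hat mult_PC_hat)
  ultimately show "f \<otimes>\<^bsub>PC_hat\<^esub> g \<in> finite_disp"
    using PC_hat.m_closed[OF carrier] unfolding finite_disp_def
    by (intro CollectI conjI bexI[of _ "E \<circ> E'"]) (simp_all only:)
qed

text \<open>The displacement is continuous on the connected arc and takes finitely many values, so
  it is constant.\<close>

lemma finite_disp_on_arc:
  assumes "continuous_on (- F) f" "E \<in> {id, uminus}" "finite (range (\<lambda>x. f x - E x))"
    and "circle_of ` {a<..<b} \<inter> F = {}"
  obtains c where "\<And>s. s \<in> {a<..<b} \<Longrightarrow> f (circle_of s) = E (circle_of s) + circle_of c"
proof -
  let ?d = "\<lambda>s. f (circle_of s) - E (circle_of s)"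
  have "continuous_on {a<..<b} (\<lambda>s. f (circle_of s))"
    by (rule continuous_on_compose2[OF assms(1) continuous_on_circle_of]) (use assms(4) in auto)
  moreover have "continuous_on {a<..<b} (\<lambda>s. E (circle_of s))"
  proof -
    have "continuous_on UNIV E" using assms(2) continuous_on_circle_uminus by auto
    then show ?thesis by (rule continuous_on_compose2[OF _ continuous_on_circle_of]) auto
  qed
  ultimately have "connected (?d ` {a<..<b})"
    by (intro connected_continuous_image continuous_on_circle_diff) auto
  moreover have "finite (?d ` {a<..<b})"
    using assms(3) by (rule rev_finite_subset) auto
  ultimately have "?d ` {a<..<b} = {} \<or> (\<exists>y. ?d ` {a<..<b} = {y})"
    by (simp only: connected_finite_iff_sing)
  then obtain y where y: "?d ` {a<..<b} \<subseteq> {y}"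
    by (metis empty_subsetI subset_refl)
  obtain c where c: "y = circle_of c" by (rule circle_of_surj)
  have "f (circle_of s) = E (circle_of s) + circle_of c" if "s \<in> {a<..<b}" for s
  proof -
    have "?d s = circle_of c" using that y c by blast
    then show ?thesis by (simp add: diff_eq_eq add.commute)
  qed
  then show ?thesis by (rule that)
qed

lemma PC_proj_finite_disp: "PC_proj ` finite_disp \<subseteq> IET_pm"
proof
  fix X assume "X \<in> PC_proj ` finite_disp"
  then obtain f E F where X: "X = PC_proj f" and f: "f \<in> carrier PC_hat"
    and E: "E \<in> {id, uminus}" "finite (range (\<lambda>x. f x - E x))"
    and F: "finite F" "continuous_on (- F) f"
    unfolding finite_disp_def carrier_PC_hat by blast
  have arc: "\<exists>c. \<forall>s\<in>{a<..<b}. f (circle_of s) = E (circle_of s) + circle_of c"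
    if "circle_of ` {a<..<b} \<inter> F = {}" for a b
    by (rule finite_disp_on_arc[OF F(2) E that]) blast
  have "isometric_on_arc a b f" if disj: "circle_of ` {a<..<b} \<inter> F = {}" for a b
  proof -
    obtain c where "\<forall>s\<in>{a<..<b}. f (circle_of s) = E (circle_of s) + circle_of c"
      using arc[OF disj] by blast
    then show ?thesis
      using E(1) by (auto simp: isometric_on_arc_def dist_circle_add dist_circle_uminus)
  qed
  then have "piecewise isometric_on_arc f"
    using F(1) by (auto simp: piecewise_def)
  moreover have "piecewise orientation_preserving_on_arc f" if "E = id"
  proof -
    have "orientation_preserving_on_arc a b f" if disj: "circle_of ` {a<..<b} \<inter> F = {}" for a b
    proof -
      obtain c where "\<forall>s\<in>{a<..<b}. f (circle_of s) = circle_of (s + c)"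
        using arc[OF disj] unfolding \<open>E = id\<close> circle_of_add id_apply by blast
      then show ?thesis
        unfolding orientation_preserving_on_arc_def
        by (intro exI[of _ "\<lambda>s. s + c"]) (auto intro!: continuous_intros strict_mono_onI)
    qed
    then show ?thesis using F(1) by (auto simp: piecewise_def)
  qed
  moreover have "piecewise orientation_reversing_on_arc f" if "E = uminus"
  proof -
    have "orientation_reversing_on_arc a b f" if disj: "circle_of ` {a<..<b} \<inter> F = {}" for a b
    proof -
      obtain c where "\<forall>s\<in>{a<..<b}. f (circle_of s) = circle_of (- s + c)"
        using arc[OF disj] unfolding \<open>E = uminus\<close> circle_of_add circle_of_minus by blast
      then show ?thesis
        unfolding orientation_reversing_on_arc_def
        by (intro exI[of _ "\<lambda>s. - s + c"]) (auto intro!: continuous_intros monotone_onI)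
    qed
    then show ?thesis using F(1) by (auto simp: piecewise_def)
  qed
  ultimately show "X \<in> IET_pm"
    using E(1) f unfolding X IET_pm_def PC_pm_def PC_plus_def PC_minus_def IET_flip_def by blast
qed

theorem theorem1p8:
  shows "\<not> realizable (carrier PC) \<and>
         \<not> realizable IET_pm \<and>
         (\<exists>\<Gamma>. subgroup \<Gamma> PC \<and> \<Gamma> \<subseteq> IET_pm \<and>
              (\<exists>X. finite X \<and> X \<subseteq> \<Gamma> \<and> \<Gamma> = generate PC X) \<and>
              \<not> realizable \<Gamma>)"
proof -
  obtain q b :: real where q: "1 / 4 < q" "q < 1 / 3" "q \<notin> \<rat>"
    and indep: "\<And>m k :: int. of_int m * q + of_int k * b \<in> \<int> \<Longrightarrow> m = 0 \<and> k = 0"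
    using exists_independent_pair by metis
  let ?gens = "{rot q, rot b, uminus, exchange q}"
  define \<Gamma> where "\<Gamma> = generate PC (PC_proj ` ?gens)"
  have rot: "rot t \<in> finite_disp" for t
  proof -
    have "continuous_on (- {}) (rot t)"
      unfolding rot_def by (rule continuous_on_circle_translation)
    then have "rot t \<in> carrier PC_hat" unfolding carrier_PC_hat using bij_rot by blast
    then show ?thesis by (auto simp: finite_disp_def rot_def)
  qed
  have flip: "uminus \<in> finite_disp"
  proof -
    have "continuous_on (- {}) (uminus :: circle \<Rightarrow> circle)"
      by (rule continuous_on_circle_uminus)
    then have "uminus \<in> carrier PC_hat" unfolding carrier_PC_hat using bij_uminus_circle by blast
    then show ?thesis by (auto simp: finite_disp_def)
  qed
  have exch: "exchange q \<in> finite_disp"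
  proof -
    have "exchange q \<in> carrier PC_hat"
      unfolding carrier_PC_hat using bij_exchange[OF q(1,2)] continuous_on_exchange[OF q(1,2)]
      by (meson finite.emptyI finite_imageI finite_insert)
    moreover have "range (\<lambda>x. exchange q x - id x) \<subseteq> {0, circle_of q, circle_of (3 * q)}"
      using exchange_disp[OF q(1,2)] unfolding id_apply by blast
    then have "finite (range (\<lambda>x. exchange q x - id x))" by (rule finite_subset) simp
    ultimately show ?thesis unfolding finite_disp_def by blast
  qed
  have gens: "?gens \<subseteq> finite_disp" using rot flip exch by blast
  have fd: "finite_disp \<subseteq> carrier PC_hat" by (auto simp: finite_disp_def)
  have sub: "subgroup \<Gamma> PC"
    unfolding \<Gamma>_def using gens fd by (intro PC.generate_is_subgroup) auto
  \<comment> \<open>Passing through a subgroup means that only the four generators need checking,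
    not the words in them.\<close>
  have "\<Gamma> \<subseteq> PC_proj ` finite_disp"
    unfolding \<Gamma>_def using gens PC_proj.subgroup_img_is_subgroup[OF subgroup_finite_disp]
    by (intro PC.generate_subgroup_incl) auto
  then have iet: "\<Gamma> \<subseteq> IET_pm" using PC_proj_finite_disp by blast
  have gen: "PC_proj ` ?gens \<subseteq> \<Gamma>"
    unfolding \<Gamma>_def by (auto intro: generate.incl)
  have not: "\<not> realizable \<Gamma>"
  proof
    assume "realizable \<Gamma>"
    then obtain \<Lambda> where \<Lambda>: "subgroup \<Lambda> PC_hat" "bij_betw PC_proj \<Lambda> \<Gamma>"
      by (auto simp: realizable_def)
    have carrier: "f \<in> carrier PC_hat" if "f \<in> \<Lambda>" for f
      using subgroup.mem_carrier[OF \<Lambda>(1) that] .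
    have lift: "\<exists>f\<in>\<Lambda>. nearly_eq f h" if h: "h \<in> ?gens" for h
    proof -
      have "PC_proj h \<in> PC_proj ` \<Lambda>"
        using gen h bij_betw_imp_surj_on[OF \<Lambda>(2)] by blast
      then obtain f where f: "f \<in> \<Lambda>" "PC_proj f = PC_proj h" by (metis imageE)
      have "h \<in> carrier PC_hat" using gens fd h by blast
      then show ?thesis using f carrier PC_proj_eq_imp_nearly_eq by blast
    qed
    obtain A where A: "A \<in> \<Lambda>" "nearly_eq A (rot q)" using lift[of "rot q"] by blast
    obtain B where B: "B \<in> \<Lambda>" "nearly_eq B (rot b)" using lift[of "rot b"] by blast
    obtain \<sigma> where \<sigma>: "\<sigma> \<in> \<Lambda>" "nearly_eq \<sigma> uminus" using lift[of uminus] by blast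
    obtain g where g: "g \<in> \<Lambda>" "nearly_eq g (exchange q)" using lift[of "exchange q"] by blast
    have bij: "bij f" if "f \<in> \<Lambda>" for f using carrier[OF that] by (simp add: carrier_PC_hat)
    show False
    proof (rule no_lift[OF q(1,2) indep q(3) bij _ _ _ A B \<sigma> g])
      show "f \<circ> h \<in> \<Lambda>" if "f \<in> \<Lambda>" "h \<in> \<Lambda>" for f h
        using subgroup.m_closed[OF \<Lambda>(1) that] bij that by (simp add: mult_PC_hat)
      show "inv_into UNIV f \<in> \<Lambda>" if "f \<in> \<Lambda>" for f
        using subgroup.m_inv_closed[OF \<Lambda>(1) that] carrier that by (simp add: inv_PC_hat)
      show "f = h" if "f \<in> \<Lambda>" "h \<in> \<Lambda>" "nearly_eq f h" for f h
        using that nearly_eq_imp_PC_proj_eq carrier bij_betw_imp_inj_on[OF \<Lambda>(2)] by (meson inj_onD)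
    qed
  qed
  have "\<not> realizable (carrier PC)"
    using realizable_subgroup[OF _ sub subgroup.subset[OF sub]] not by blast
  moreover have "\<not> realizable IET_pm"
    using realizable_subgroup[OF _ sub iet] not by blast
  moreover have "finite (PC_proj ` ?gens)" by simp
  ultimately show ?thesis
    using sub iet gen not \<Gamma>_def by blast
qed

end
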